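(* Consider linear contextual bandits in which the observed rewards are adversarially corrupted with total corruption budget $C$. Let $\Pi$ denote all admissible policies that are $(1-\delta)$-fair with $\delta=\Theta(1/T)$, and let $\mathcal P$ be the class of problem instances satisfying Assumptions A1–A3. Then $\inf_{\pi\in\Pi}\sup_{\mathbb P\in\mathcal P}R_T(\pi)=\Omega(\log^2T+C)$.
   Context: Linear contextual bandit: arms $\mathcal K=\{1,\dots,K\}$, horizon $T$; context $x_t\in\mathbb R^{d-1}$, $z_t=(1,x_t^\top)^\top$; arm $k$ has unknown $\beta_k\in\mathbb R^d$ and mean reward $f_k^*(x)=(1,x^\top)\beta_k$. Pulling $\pi_t=k$ reveals $\tilde y_t=z_t^\top\beta_k+c_t+\varepsilon_{k,t}$ with i.i.d. noise independent of contexts, where an adversary knowing all $f_k^*$, $x_t$ and $\pi_t$ chooses $c_t$ subject to $\sum_{t=1}^T|c_t|\le C$. $\mathcal F_{t-1}$: $\sigma$-field of past contexts, arms and observed rewards. Admissible policy: $\pi_t$ determined by $\mathcal F_{t-1}$, $x_t$ and independent randomization. Regret (true rewards): $R_T(\pi)=E\sum_t(\max_kf_k^*(x_t)-f^*_{\pi_t}(x_t))$. $(1-\delta)$-fairness: with probability at least $1-\delta$, for all $t\in[T]$, contexts $x$, arms $i,j$: $P(\pi_t=i\mid x_t=x,\mathcal F_{t-1})>P(\pi_t=j\mid x_t=x,\mathcal F_{t-1})$ only if $f_i^*(x)>f_j^*(x)$. Assumption A1: contexts i.i.d. with Lebesgue density, support $\mathcal X\subseteq[-r,r]^{d-1}$,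 $r\ge1$; $\|\beta_k\|_2\le b$. A2: there is $L$ with $P(0<|z_t^\top(\beta_i-\beta_j)|\le\rho)\le L\rho$ for $i\ne j$, $\rho>0$. A3: there are $h,\tilde p>0$ with $P(z_t\in Q_k)\ge\tilde p$ for all $k$, $Q_k=\{z:z^\top\beta_k>\max_{j\ne k}z^\top\beta_j+h\}$, and $\lambda^*>0$ with $\min_i\lambda_{\min}(E[z_tz_t^\top\mid z_t\in Q_i])\ge\lambda^*$.
   Formalization: The bound is stated for K ≥ 2 arms and 0 ≤ C ≤ T, for suitable fixed constants in A1–A3 and sub-Gaussian noise; without C ≤ T it fails (regret is at most a constant times T, so e.g. C = T² violates it), and with one arm regret is zero. *)

theory Defs
  imports "HOL-Probability.Probability" "HOL-Library.Landau_Symbols"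
begin

text \<open>
Linear contextual bandit with K arms (arms are 0,...,K-1), contexts in an abstract
Euclidean space of dimension d-1 (type 'x), horizon T.
A history up to round t is a function h :: nat => 'x * nat * real whose entries
i < t are (context, pulled arm, observed corrupted reward) and which is undefined
at positions >= t (so that it lies in the space of PiM {..<t}).
\<close>

type_synonym 'x hist = "nat \<Rightarrow> 'x \<times> nat \<times> real"

text \<open>Mean reward of an arm with parameter beta = (intercept, slope) at context x,
i.e. (1, x^T) beta.\<close>
definition lin :: "real \<times> 'x::euclidean_space \<Rightarrow> 'x \<Rightarrow> real" where
  "lin \<beta> x = fst \<beta> + snd \<beta> \<bullet> x"

definition best_val :: "nat \<Rightarrow> (nat \<Rightarrow> real \<times> 'x::euclidean_space) \<Rightarrow> 'x \<Rightarrow> real" where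
  "best_val K \<beta> x = Max {lin (\<beta> j) x | j. j < K}"

definition step_M :: "('x::euclidean_space \<times> nat \<times> real) measure" where
  "step_M = borel \<Otimes>\<^sub>M count_space UNIV \<Otimes>\<^sub>M borel"

definition hist_M :: "nat \<Rightarrow> 'x::euclidean_space hist measure" where
  "hist_M t = PiM {..<t} (\<lambda>_. step_M)"

definition empty_hist :: "'x hist" where
  "empty_hist = (\<lambda>_. undefined)"

definition prefix_hist :: "'x hist \<Rightarrow> nat \<Rightarrow> 'x hist" where
  "prefix_hist H t = (\<lambda>i. if i < t then H i else undefined)"

text \<open>Admissible (behavioural) policy: at round t, given the past history h (F_{t-1})
and the current context x, pol t h x is the conditional distribution of the pulled arm
(this realises "determined by F_{t-1}, x_t and independent randomization").\<close>
definition admissible_policy :: "nat \<Rightarrow> (nat \<Rightarrow> 'x::euclidean_space hist \<Rightarrow> 'x \<Rightarrow> nat pmf) \<Rightarrow> bool" where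
  "admissible_policy K pol \<longleftrightarrow>
     (\<forall>t h x. set_pmf (pol t h x) \<subseteq> {..<K}) \<and>
     (\<forall>t k. (\<lambda>(h, x). pmf (pol t h x) k) \<in> borel_measurable (hist_M t \<Otimes>\<^sub>M borel))"

text \<open>Adversary: corruption c_t = adv t h x k, chosen knowing the past, the current
context and the pulled arm (and the instance), with total budget C on every path.\<close>
definition admissible_adversary :: "nat \<Rightarrow> real \<Rightarrow> (nat \<Rightarrow> 'x::euclidean_space hist \<Rightarrow> 'x \<Rightarrow> nat \<Rightarrow> real) \<Rightarrow> bool" where
  "admissible_adversary T C adv \<longleftrightarrow>
     (\<forall>t k. (\<lambda>(h, x). adv t h x k) \<in> borel_measurable (hist_M t \<Otimes>\<^sub>M borel)) \<and>
     (\<forall>H :: 'x hist. (\<Sum>t<T. \<bar>adv t (prefix_hist H t) (fst (H t)) (fst (snd (H t)))\<bar>) \<le> C)"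

primrec regret_from ::
  "nat \<Rightarrow> nat \<Rightarrow> (nat \<Rightarrow> real \<times> 'x::euclidean_space) \<Rightarrow> 'x measure \<Rightarrow> real measure \<Rightarrow>
   (nat \<Rightarrow> 'x hist \<Rightarrow> 'x \<Rightarrow> nat \<Rightarrow> real) \<Rightarrow> (nat \<Rightarrow> 'x hist \<Rightarrow> 'x \<Rightarrow> nat pmf) \<Rightarrow>
   nat \<Rightarrow> 'x hist \<Rightarrow> ennreal" where
  "regret_from 0 K \<beta> D N adv pol t h = 0"
| "regret_from (Suc n) K \<beta> D N adv pol t h =
     (\<integral>\<^sup>+ x. (\<Sum>k<K. ennreal (pmf (pol t h x) k) *
        (ennreal (best_val K \<beta> x - lin (\<beta> k) x) +
         (\<integral>\<^sup>+ e. regret_from n K \<beta> D N adv pol (Suc t)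
                 (h(t := (x, k, lin (\<beta> k) x + adv t h x k + e))) \<partial>N))) \<partial>D)"

definition regret ::
  "nat \<Rightarrow> nat \<Rightarrow> (nat \<Rightarrow> real \<times> 'x::euclidean_space) \<Rightarrow> 'x measure \<Rightarrow> real measure \<Rightarrow>
   (nat \<Rightarrow> 'x hist \<Rightarrow> 'x \<Rightarrow> nat \<Rightarrow> real) \<Rightarrow> (nat \<Rightarrow> 'x hist \<Rightarrow> 'x \<Rightarrow> nat pmf) \<Rightarrow> ennreal" where
  "regret T K \<beta> D N adv pol = regret_from T K \<beta> D N adv pol 0 empty_hist"

definition ctx_support :: "'x::euclidean_space measure \<Rightarrow> 'x set" where
  "ctx_support D = {x. \<forall>e>0. emeasure D (ball x e) > 0}"

definition fair_round ::
  "nat \<Rightarrow> (nat \<Rightarrow> real \<times> 'x::euclidean_space) \<Rightarrow> 'x measure \<Rightarrow>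
   (nat \<Rightarrow> 'x hist \<Rightarrow> 'x \<Rightarrow> nat pmf) \<Rightarrow> nat \<Rightarrow> 'x hist \<Rightarrow> bool" where
  "fair_round K \<beta> D pol t h \<longleftrightarrow>
     (\<forall>x\<in>ctx_support D. \<forall>i<K. \<forall>j<K.
        pmf (pol t h x) i > pmf (pol t h x) j \<longrightarrow> lin (\<beta> i) x > lin (\<beta> j) x)"

primrec fair_prob_from ::
  "nat \<Rightarrow> nat \<Rightarrow> (nat \<Rightarrow> real \<times> 'x::euclidean_space) \<Rightarrow> 'x measure \<Rightarrow> real measure \<Rightarrow>
   (nat \<Rightarrow> 'x hist \<Rightarrow> 'x \<Rightarrow> nat \<Rightarrow> real) \<Rightarrow> (nat \<Rightarrow> 'x hist \<Rightarrow> 'x \<Rightarrow> nat pmf) \<Rightarrow>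
   nat \<Rightarrow> 'x hist \<Rightarrow> ennreal" where
  "fair_prob_from 0 K \<beta> D N adv pol t h = 1"
| "fair_prob_from (Suc n) K \<beta> D N adv pol t h =
     (if fair_round K \<beta> D pol t h then 1 else 0) *
     (\<integral>\<^sup>+ x. (\<Sum>k<K. ennreal (pmf (pol t h x) k) *
        (\<integral>\<^sup>+ e. fair_prob_from n K \<beta> D N adv pol (Suc t)
                 (h(t := (x, k, lin (\<beta> k) x + adv t h x k + e))) \<partial>N)) \<partial>D)"

definition fair_prob ::
  "nat \<Rightarrow> nat \<Rightarrow> (nat \<Rightarrow> real \<times> 'x::euclidean_space) \<Rightarrow> 'x measure \<Rightarrow> real measure \<Rightarrow>
   (nat \<Rightarrow> 'x hist \<Rightarrow> 'x \<Rightarrow> nat \<Rightarrow> real) \<Rightarrow> (nat \<Rightarrow> 'x hist \<Rightarrow> 'x \<Rightarrow> nat pmf) \<Rightarrow> ennreal" where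
  "fair_prob T K \<beta> D N adv pol = fair_prob_from T K \<beta> D N adv pol 0 empty_hist"

definition Q_set :: "nat \<Rightarrow> (nat \<Rightarrow> real \<times> 'x::euclidean_space) \<Rightarrow> real \<Rightarrow> nat \<Rightarrow> 'x set" where
  "Q_set K \<beta> hh k = {x. \<forall>j<K. j \<noteq> k \<longrightarrow> lin (\<beta> k) x > lin (\<beta> j) x + hh}"

text \<open>Assumptions A1-A3 on (context distribution D, arm parameters beta), plus the noise
distribution N being mean-zero sigma-sub-Gaussian (i.i.d. noise).
The smallest eigenvalue of E[z z^T | z in Q_k] is written via its variational
(Rayleigh quotient) definition: v^T E[z z^T | Q_k] v >= lambda* |v|^2 for all v.\<close>
definition problem_instance ::
  "nat \<Rightarrow> real \<Rightarrow> real \<Rightarrow> real \<Rightarrow> real \<Rightarrow> real \<Rightarrow> real \<Rightarrow> real \<Rightarrow>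
   'x::euclidean_space measure \<Rightarrow> (nat \<Rightarrow> real \<times> 'x) \<Rightarrow> real measure \<Rightarrow> bool" where
  "problem_instance K r b L hh pt lam \<sigma> D \<beta> N \<longleftrightarrow>
     \<comment> \<open>A1\<close>
     prob_space D \<and> sets D = sets borel \<and>
     (\<exists>p. p \<in> borel_measurable lborel \<and> D = density lborel p) \<and>
     ctx_support D \<subseteq> {x. \<forall>i\<in>Basis. \<bar>x \<bullet> i\<bar> \<le> r} \<and>
     (\<forall>k<K. norm (\<beta> k) \<le> b) \<and>
     \<comment> \<open>A2\<close>
     (\<forall>i<K. \<forall>j<K. i \<noteq> j \<longrightarrow> (\<forall>\<rho>>0.
        measure D {x. 0 < \<bar>lin (\<beta> i) x - lin (\<beta> j) x\<bar> \<and> \<bar>lin (\<beta> i) x - lin (\<beta> j) x\<bar> \<le> \<rho>}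
          \<le> L * \<rho>)) \<and>
     \<comment> \<open>A3\<close>
     (\<forall>k<K. measure D (Q_set K \<beta> hh k) \<ge> pt) \<and>
     (\<forall>k<K. \<forall>v :: real \<times> 'x.
        (LINT x:Q_set K \<beta> hh k|D. (lin v x)\<^sup>2) / measure D (Q_set K \<beta> hh k) \<ge> lam * (norm v)\<^sup>2) \<and>
     \<comment> \<open>noise\<close>
     prob_space N \<and> sets N = sets borel \<and>
     (\<forall>l. integrable N (\<lambda>e. exp (l * e)) \<and> (\<integral>e. exp (l * e) \<partial>N) \<le> exp (l\<^sup>2 * \<sigma>\<^sup>2 / 2))"

definition instances ::
  "nat \<Rightarrow> real \<Rightarrow> real \<Rightarrow> real \<Rightarrow> real \<Rightarrow> real \<Rightarrow> real \<Rightarrow> real \<Rightarrow> nat \<Rightarrow> real \<Rightarrow>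
   ('x::euclidean_space measure \<times> (nat \<Rightarrow> real \<times> 'x) \<times> real measure \<times>
    (nat \<Rightarrow> 'x hist \<Rightarrow> 'x \<Rightarrow> nat \<Rightarrow> real)) set" where
  "instances K r b L hh pt lam \<sigma> T C =
     {(D, \<beta>, N, adv). problem_instance K r b L hh pt lam \<sigma> D \<beta> N \<and> admissible_adversary T C adv}"

definition fair_policies ::
  "nat \<Rightarrow> real \<Rightarrow> real \<Rightarrow> real \<Rightarrow> real \<Rightarrow> real \<Rightarrow> real \<Rightarrow> real \<Rightarrow> nat \<Rightarrow> real \<Rightarrow> real \<Rightarrow>
   (nat \<Rightarrow> 'x::euclidean_space hist \<Rightarrow> 'x \<Rightarrow> nat pmf) set" where
  "fair_policies K r b L hh pt lam \<sigma> T C \<delta> =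
     {pol. admissible_policy K pol \<and>
       (\<forall>(D, \<beta>, N, adv) \<in> instances K r b L hh pt lam \<sigma> T C.
          fair_prob T K \<beta> D N adv pol \<ge> ennreal (1 - \<delta>))}"

end

theory Submission
  imports Defs "HOL-Real_Asymp.Real_Asymp"
begin

text \<open>
Let \<open>P\<close> be an instance with unit normal noise in which arm 1 beats arm 0 by a gap in \<open>(\<rho>/2, \<rho>)\<close> on a
region of contexts of probability of order \<open>\<rho>\<close>, and let \<open>P'\<close> be the same instance with arm 0 raised
by \<open>\<rho>\<close>, so that arm 0 is the better one there.  Fairness under \<open>P'\<close> forbids preferring arm 1 on the
region, except on an event of probability \<open>O(1/T)\<close>.  As long as the chi-square distance of
the laws of the first \<open>s\<close> rounds, at most \<open>exp (s \<Delta>\<^sup>2)\<close> for observed means that differ by at most \<open>\<Delta>\<close>,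
is at most \<open>sqrt T\<close>, this event still has probability at most 1/2 under \<open>P\<close>, and round \<open>s\<close> costs
regret of order \<open>\<rho>\<^sup>2\<close> under \<open>P\<close>.

Without corruption \<open>\<Delta> = \<rho>\<close>, and \<open>\<rho>\<^sup>2\<close> of order \<open>ln T / s\<close> is allowed in round \<open>s\<close>: summing
over \<open>s\<close> gives \<open>(ln T)\<^sup>2\<close>.  If the adversary raises the observed rewards of arm 0 by a constant \<open>\<rho>\<close> in the
first \<open>C\<close> rounds of \<open>P\<close>, then \<open>\<Delta> = 0\<close> in these rounds, and each of them costs a constant.
\<close>

section \<open>Change of measure for unit normal noise\<close>

abbreviation std_normal :: "real measure" where
  "std_normal \<equiv> density lborel (\<lambda>x. ennreal (std_normal_density x))"

lemma nn_integral_std_normal_shift: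
  assumes [measurable]: "f \<in> borel_measurable borel"
  shows "(\<integral>\<^sup>+ e. f (m + e) \<partial>std_normal) = (\<integral>\<^sup>+ y. ennreal (normal_density m 1 y) * f y \<partial>lborel)"
proof -
  have "(\<integral>\<^sup>+ y. ennreal (normal_density m 1 y) * f y \<partial>lborel)
      = (\<integral>\<^sup>+ e. ennreal (normal_density m 1 (m + 1 * e)) * f (m + 1 * e) \<partial>lborel)"
    by (subst nn_integral_real_affine[where c = 1 and t = m]) auto
  also have "\<dots> = (\<integral>\<^sup>+ e. f (m + e) \<partial>std_normal)"
    by (subst nn_integral_density) (auto simp: normal_density_def)
  finally show ?thesis by simp
qed

lemma nn_integral_normal_density: "(\<integral>\<^sup>+ y. ennreal (normal_density m 1 y) \<partial>lborel) = 1"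
  by (subst nn_integral_eq_integral) auto

text \<open>Completing the square shows that the chi-square integrand is a multiple of the unit
  normal density centred at \<open>2 * m - m'\<close>. Its integral is thus
  \<open>exp ((m - m')\<^sup>2)\<close>, the factor that one observed reward contributes to the
  second moment of the likelihood ratio.\<close>

lemma normal_density_chi_square:
  "(normal_density m 1 y)\<^sup>2 / normal_density m' 1 y
    = exp ((m - m')\<^sup>2) * normal_density (2 * m - m') 1 y"
proof -
  have e: "2 * (-(y - m)\<^sup>2 / 2) - (-(y - m')\<^sup>2 / 2) = (m - m')\<^sup>2 + (- (y - (2 * m - m'))\<^sup>2 / 2)"
    by (simp add: power2_eq_square field_simps)
  have "(exp (-(y - m)\<^sup>2 / 2))\<^sup>2 / exp (-(y - m')\<^sup>2 / 2)
      = exp (2 * (-(y - m)\<^sup>2 / 2) - (-(y - m')\<^sup>2 / 2))"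
    by (simp add: exp_diff exp_minus power2_eq_square field_simps flip: exp_add)
  also have "\<dots> = exp ((m - m')\<^sup>2) * exp (- (y - (2 * m - m'))\<^sup>2 / 2)"
    by (simp only: e exp_add)
  finally show ?thesis
    by (simp add: normal_density_def power_divide power2_eq_square field_simps)
qed

text \<open>A change of measure in which the Cauchy-Schwarz inequality
  \<open>E f \<le> sqrt (E' f) * sqrt (E' (dP/dP')\<^sup>2)\<close> is linearised by a Young parameter \<open>l\<close>.
  Since \<open>l\<close> is arbitrary, it may be multiplied by the likelihood ratio pointwise.\<close>

lemma std_normal_change_of_measure:
  assumes [measurable]: "f \<in> borel_measurable borel" "f' \<in> borel_measurable borel"
    and le: "\<And>l y. l > 0 \<Longrightarrow> ennreal l * f' y + 1 \<le> f y + ennreal (l + B / (4 * l))"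
    and l: "l > 0" and B: "B \<ge> 0" and \<Delta>: "\<bar>m - m'\<bar> \<le> \<Delta>"
  shows "ennreal l * (\<integral>\<^sup>+ e. f' (m' + e) \<partial>std_normal) + 1
    \<le> (\<integral>\<^sup>+ e. f (m + e) \<partial>std_normal) + ennreal (l + exp (\<Delta>\<^sup>2) * B / (4 * l))"
proof -
  let ?p = "normal_density m 1" and ?q = "normal_density m' 1" and ?r = "normal_density (2 * m - m') 1"
  let ?c = "exp ((m - m')\<^sup>2) * B / (4 * l)"
  have pw: "ennreal l * (ennreal (?q y) * f' y) + ennreal (?p y)
      \<le> ennreal (?p y) * f y + (ennreal l * ennreal (?q y) + ennreal ?c * ennreal (?r y))" for y
  proof -
    have p: "?p y > 0" and q: "?q y > 0" by (simp_all add: normal_density_pos)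
    \<comment> \<open>This choice turns \<open>?p y * k\<close> into \<open>l * ?q y\<close>, and
      \<open>?p y / k\<close> into the chi-square integrand divided by \<open>l\<close>.\<close>
    define k where "k = l * ?q y / ?p y"
    have k: "k > 0" using p q l by (simp add: k_def)
    have "ennreal (?p y) * (ennreal k * f' y + 1) \<le> ennreal (?p y) * (f y + ennreal (k + B / (4 * k)))"
      by (intro mult_left_mono le k) auto
    moreover have "ennreal (?p y) * (ennreal k * f' y + 1) = ennreal l * (ennreal (?q y) * f' y) + ennreal (?p y)"
    proof -
      have "ennreal (?p y) * ennreal k = ennreal l * ennreal (?q y)"
        using p q l k by (simp add: k_def flip: ennreal_mult)
      then show ?thesis by (simp add: distrib_left flip: mult.assoc)
    qed
    moreover have "ennreal (?p y) * ennreal (k + B / (4 * k)) = ennreal l * ennreal (?q y) + ennreal ?c * ennreal (?r y)"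
    proof -
      have "?p y * (k + B / (4 * k)) = l * ?q y + B / (4 * l) * ((?p y)\<^sup>2 / ?q y)"
        using p q l by (simp add: k_def field_simps power2_eq_square)
      also have "\<dots> = l * ?q y + ?c * ?r y"
        unfolding normal_density_chi_square by simp
      finally show ?thesis
        using p q l k B by (simp flip: ennreal_mult ennreal_plus)
    qed
    ultimately show ?thesis by (simp add: distrib_left)
  qed
  have "ennreal l * (\<integral>\<^sup>+ e. f' (m' + e) \<partial>std_normal) + 1
     = (\<integral>\<^sup>+ y. ennreal l * (ennreal (?q y) * f' y) + ennreal (?p y) \<partial>lborel)"
    by (simp add: nn_integral_std_normal_shift nn_integral_add nn_integral_cmult nn_integral_normal_density)
  also have "\<dots> \<le> (\<integral>\<^sup>+ y. ennreal (?p y) * f y + (ennreal l * ennreal (?q y) + ennreal ?c * ennreal (?r y)) \<partial>lborel)"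
    by (intro nn_integral_mono pw)
  also have "\<dots> = (\<integral>\<^sup>+ e. f (m + e) \<partial>std_normal) + (ennreal l + ennreal ?c)"
    by (simp add: nn_integral_std_normal_shift nn_integral_add nn_integral_cmult nn_integral_normal_density)
  also have "\<dots> \<le> (\<integral>\<^sup>+ e. f (m + e) \<partial>std_normal) + ennreal (l + exp (\<Delta>\<^sup>2) * B / (4 * l))"
  proof -
    have "(m - m')\<^sup>2 \<le> \<Delta>\<^sup>2" using power_mono[OF \<Delta> abs_ge_zero, of 2] by simp
    then have "?c \<le> exp (\<Delta>\<^sup>2) * B / (4 * l)"
      using B l by (intro divide_right_mono mult_right_mono) auto
    then show ?thesis using l B by (intro add_left_mono) (simp flip: ennreal_plus)
  qed
  finally show ?thesis .
qed

section \<open>Expectations along the bandit process\<close>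

locale bandit_process =
  fixes K :: nat and D :: "'x::euclidean_space measure" and N :: "real measure"
    and pol :: "nat \<Rightarrow> 'x hist \<Rightarrow> 'x \<Rightarrow> nat pmf"
  assumes prob_D: "prob_space D" and sets_D[measurable_cong]: "sets D = sets borel"
    and prob_N: "prob_space N" and sets_N[measurable_cong]: "sets N = sets borel"
    and pol: "admissible_policy K pol"
begin

text \<open>\<open>\<mu>\<close> is the mean of the observed reward, corruption included. Instances
  that share \<open>D\<close>, \<open>N\<close> and the policy then differ only in
  \<open>\<mu>\<close>, whether by their arms or by their adversaries.\<close>

definition round_step :: "(nat \<Rightarrow> 'x hist \<Rightarrow> 'x \<Rightarrow> nat \<Rightarrow> real) \<Rightarrow> nat \<Rightarrow> ('x hist \<Rightarrow> ennreal) \<Rightarrow> 'x hist \<Rightarrow> ennreal" where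
  "round_step \<mu> t \<Phi> h = (\<integral>\<^sup>+ x. (\<Sum>k<K. ennreal (pmf (pol t h x) k) *
     (\<integral>\<^sup>+ e. \<Phi> (h(t := (x, k, \<mu> t h x k + e))) \<partial>N)) \<partial>D)"

text \<open>The recursion copies that of \<open>fair_prob_from\<close> and
  \<open>regret_from\<close>, so that no measure on whole trajectories has to be
  constructed.\<close>

primrec expect_from :: "nat \<Rightarrow> (nat \<Rightarrow> 'x hist \<Rightarrow> 'x \<Rightarrow> nat \<Rightarrow> real) \<Rightarrow> ('x hist \<Rightarrow> ennreal) \<Rightarrow> nat \<Rightarrow> 'x hist \<Rightarrow> ennreal" where
  "expect_from 0 \<mu> F t h = F h"
| "expect_from (Suc n) \<mu> F t h = round_step \<mu> t (expect_from n \<mu> F (Suc t)) h"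

definition measurable_mean :: "(nat \<Rightarrow> 'x hist \<Rightarrow> 'x \<Rightarrow> nat \<Rightarrow> real) \<Rightarrow> bool" where
  "measurable_mean \<mu> \<longleftrightarrow> (\<forall>t k. (\<lambda>(h, x). \<mu> t h x k) \<in> borel_measurable (hist_M t \<Otimes>\<^sub>M borel))"

lemma sigma_finite_D: "sigma_finite_measure D"
  using prob_D by (simp add: prob_space_imp_sigma_finite)

lemma sigma_finite_N: "sigma_finite_measure N"
  using prob_N by (simp add: prob_space_imp_sigma_finite)

lemma space_D: "space D = UNIV"
  using sets_eq_imp_space_eq[OF sets_D] by simp

lemma emeasure_space_eq_1: "emeasure D UNIV = 1" "emeasure N (space N) = 1"
  using prob_space.emeasure_space_1[OF prob_D] prob_space.emeasure_space_1[OF prob_N] 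
  by (simp_all add: space_D)

lemma pmf_measurable: "(\<lambda>(h, x). pmf (pol t h x) k) \<in> borel_measurable (hist_M t \<Otimes>\<^sub>M borel)"
  using pol by (simp add: admissible_policy_def)

lemma sum_pmf_eq_1: "(\<Sum>k<K. pmf (pol t h x) k) = 1"
  using pol by (intro sum_pmf_eq_1) (auto simp: admissible_policy_def)

lemma sum_ennreal_pmf_eq_1: "(\<Sum>k<K. ennreal (pmf (pol t h x) k)) = 1"
  by (simp add: sum_pmf_eq_1)

section \<open>Measurability of the one-round operator in the history\<close>

lemma hist_upd_measurable:
  assumes "f \<in> M \<rightarrow>\<^sub>M hist_M t" "g \<in> M \<rightarrow>\<^sub>M borel" "y \<in> M \<rightarrow>\<^sub>M borel"
  shows "(\<lambda>w. (f w)(t := (g w, k, y w))) \<in> M \<rightarrow>\<^sub>M hist_M (Suc t)"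
  unfolding hist_M_def
proof (rule measurable_fun_upd)
  show "f \<in> M \<rightarrow>\<^sub>M Pi\<^sub>M {..<t} (\<lambda>_. step_M)" using assms(1) by (simp add: hist_M_def)
  show "(\<lambda>w. (g w, k, y w)) \<in> M \<rightarrow>\<^sub>M step_M"
    unfolding step_M_def using assms(2,3) by measurable
qed auto

lemma hist_upd_in_space:
  assumes "h \<in> space (hist_M t)"
  shows "h(t := (x, k, y)) \<in> space (hist_M (Suc t))"
proof -
  have "(\<lambda>w::unit. h(t := (x, k, y))) \<in> count_space UNIV \<rightarrow>\<^sub>M hist_M (Suc t)"
    by (rule hist_upd_measurable[of "\<lambda>_. h" _ _ "\<lambda>_. x" "\<lambda>_. y"]) (use assms in auto)
  from measurable_space[OF this] show ?thesis by simp
qed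

lemma mean_measurable_comp:
  assumes "measurable_mean \<mu>" "f \<in> M \<rightarrow>\<^sub>M hist_M t" "g \<in> M \<rightarrow>\<^sub>M borel"
  shows "(\<lambda>w. \<mu> t (f w) (g w) k) \<in> borel_measurable M"
  using measurable_compose[OF measurable_Pair[OF assms(2,3)], of "\<lambda>(h, x). \<mu> t h x k" borel] assms(1)
  by (simp add: measurable_mean_def)

lemma pmf_measurable_comp:
  assumes "f \<in> M \<rightarrow>\<^sub>M hist_M t" "g \<in> M \<rightarrow>\<^sub>M borel"
  shows "(\<lambda>w. pmf (pol t (f w) (g w)) k) \<in> borel_measurable M"
  using measurable_compose[OF measurable_Pair[OF assms] pmf_measurable[of t k]] by simp

lemma inner_measurable:
  assumes \<mu>: "measurable_mean \<mu>" and \<Phi>: "\<Phi> \<in> borel_measurable (hist_M (Suc t))"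
    and f: "f \<in> M \<rightarrow>\<^sub>M hist_M t" and g: "g \<in> M \<rightarrow>\<^sub>M borel"
  shows "(\<lambda>w. ennreal (pmf (pol t (f w) (g w)) k) *
     (\<integral>\<^sup>+ e. \<Phi> ((f w)(t := (g w, k, \<mu> t (f w) (g w) k + e))) \<partial>N)) \<in> borel_measurable M"
proof -
  have f1: "(\<lambda>p. f (fst p)) \<in> M \<Otimes>\<^sub>M N \<rightarrow>\<^sub>M hist_M t" and g1: "(\<lambda>p. g (fst p)) \<in> M \<Otimes>\<^sub>M N \<rightarrow>\<^sub>M borel"
    using f g by measurable
  have e: "snd \<in> M \<Otimes>\<^sub>M N \<rightarrow>\<^sub>M borel"
    by (simp add: sets_N cong: measurable_cong_sets) measurable
  have y: "(\<lambda>p. \<mu> t (f (fst p)) (g (fst p)) k + snd p) \<in> M \<Otimes>\<^sub>M N \<rightarrow>\<^sub>M borel"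
    by (intro borel_measurable_add mean_measurable_comp[OF \<mu> f1 g1] e)
  have "(\<lambda>p. \<Phi> ((f (fst p))(t := (g (fst p), k, \<mu> t (f (fst p)) (g (fst p)) k + snd p))))
      \<in> borel_measurable (M \<Otimes>\<^sub>M N)"
    by (rule measurable_compose[OF hist_upd_measurable[OF f1 g1 y] \<Phi>])
  then have "(\<lambda>w. \<integral>\<^sup>+ e. \<Phi> ((f w)(t := (g w, k, \<mu> t (f w) (g w) k + e))) \<partial>N) \<in> borel_measurable M"
    by (intro sigma_finite_measure.borel_measurable_nn_integral[OF sigma_finite_N]) (simp add: case_prod_beta')
  with pmf_measurable_comp[OF f g] show ?thesis by measurable
qed

lemma inner_measurable_context:
  assumes "measurable_mean \<mu>" "\<Phi> \<in> borel_measurable (hist_M (Suc t))" "h \<in> space (hist_M t)"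
  shows "(\<lambda>x. ennreal (pmf (pol t h x) k) *
     (\<integral>\<^sup>+ e. \<Phi> (h(t := (x, k, \<mu> t h x k + e))) \<partial>N)) \<in> borel_measurable D"
  by (rule inner_measurable[OF assms(1,2), of "\<lambda>_. h" D "\<lambda>x. x"]) (use assms(3) in \<open>auto simp: measurable_cong_sets[OF sets_D refl]\<close>)

lemma pmf_measurable_context:
  assumes "h \<in> space (hist_M t)"
  shows "(\<lambda>x. pmf (pol t h x) k) \<in> borel_measurable D"
  by (rule pmf_measurable_comp[of "\<lambda>_. h" D _ "\<lambda>x. x"]) (use assms in \<open>auto simp: measurable_cong_sets[OF sets_D refl]\<close>)

lemma noise_measurable:
  assumes "\<Phi> \<in> borel_measurable (hist_M (Suc t))" "h \<in> space (hist_M t)"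
  shows "(\<lambda>y. \<Phi> (h(t := (x, k, y)))) \<in> borel_measurable borel"
  by (rule measurable_compose[OF hist_upd_measurable[of "\<lambda>_. h" _ _ "\<lambda>_. x" "\<lambda>y. y"] assms(1)]) (use assms(2) in auto)

lemma round_step_measurable:
  assumes \<mu>: "measurable_mean \<mu>" and \<Phi>: "\<Phi> \<in> borel_measurable (hist_M (Suc t))"
  shows "round_step \<mu> t \<Phi> \<in> borel_measurable (hist_M t)"
  unfolding round_step_def[abs_def]
proof (rule sigma_finite_measure.borel_measurable_nn_integral[OF sigma_finite_D])
  have s: "snd \<in> hist_M t \<Otimes>\<^sub>M D \<rightarrow>\<^sub>M borel"
    using measurable_snd[of "hist_M t" D] by (simp add: measurable_cong_sets[OF refl sets_D])
  show "(\<lambda>(h, x). \<Sum>k<K. ennreal (pmf (pol t h x) k) *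
     (\<integral>\<^sup>+ e. \<Phi> (h(t := (x, k, \<mu> t h x k + e))) \<partial>N)) \<in> borel_measurable (hist_M t \<Otimes>\<^sub>M D)"
    unfolding case_prod_beta'
    by (intro borel_measurable_sum inner_measurable[OF \<mu> \<Phi> measurable_fst s])
qed

lemma expect_from_measurable:
  assumes "measurable_mean \<mu>" "F \<in> borel_measurable (hist_M (t + n))"
  shows "expect_from n \<mu> F t \<in> borel_measurable (hist_M t)"
  using assms(2)
proof (induction n arbitrary: t)
  case (Suc n)
  then show ?case using round_step_measurable[OF assms(1) Suc.IH[of "Suc t"]] by (simp add: expect_from.simps(2)[abs_def])
next
  case 0
  then show ?case by (simp add: expect_from.simps(1)[abs_def])
qed

section \<open>Monotonicity, and the fairness probability as an expectation\<close>

lemma round_step_mono: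
  assumes "\<And>x k y. \<Phi> (h(t := (x, k, y))) \<le> \<Psi> (h(t := (x, k, y)))"
  shows "round_step \<mu> t \<Phi> h \<le> round_step \<mu> t \<Psi> h"
  unfolding round_step_def by (intro nn_integral_mono sum_mono mult_left_mono assms) auto

lemma round_step_le_1:
  assumes "\<And>h. \<Phi> h \<le> 1"
  shows "round_step \<mu> t \<Phi> h \<le> 1"
proof -
  have "round_step \<mu> t \<Phi> h \<le> round_step \<mu> t (\<lambda>_. 1) h" by (rule round_step_mono) (rule assms)
  also have "\<dots> = 1"
    by (simp add: round_step_def emeasure_space_eq_1 space_D sum_ennreal_pmf_eq_1)
  finally show ?thesis .
qed

lemma expect_from_le_1: "(\<And>h. F h \<le> 1) \<Longrightarrow> expect_from n \<mu> F t h \<le> 1"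
  by (induction n arbitrary: t h) (auto intro: round_step_le_1)

lemma fair_prob_from_Suc:
  "fair_prob_from (Suc n) K \<beta> D N adv pol t h =
    (if fair_round K \<beta> D pol t h then 1 else 0) *
    round_step (\<lambda>t h x k. lin (\<beta> k) x + adv t h x k) t (fair_prob_from n K \<beta> D N adv pol (Suc t)) h"
  by (simp add: round_step_def)

lemma fair_prob_from_le_1: "fair_prob_from n K \<beta> D N adv pol t h \<le> 1"
proof (induction n arbitrary: t h)
  case (Suc n)
  then show ?case
    using round_step_le_1[of "fair_prob_from n K \<beta> D N adv pol (Suc t)"]
    unfolding fair_prob_from_Suc by auto
qed simp

text \<open>Fairness in all rounds implies fairness in round \<open>t + j\<close>: the other
  fairness indicators are bounded by 1, and the later rounds have mass at most 1. Only monotonicity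
  of the integral enters, so the fairness event may be non-measurable.\<close>

lemma fair_prob_from_le_expect:
  assumes "\<And>h. fair_round K \<beta> D pol (t + j) h \<Longrightarrow> F h \<ge> 1" and "j < n"
  shows "fair_prob_from n K \<beta> D N adv pol t h \<le> expect_from j (\<lambda>t h x k. lin (\<beta> k) x + adv t h x k) F t h"
  using assms
proof (induction j arbitrary: n t h)
  case 0
  then obtain n' where "n = Suc n'" by (cases n) auto
  moreover have "round_step \<mu> t (fair_prob_from n' K \<beta> D N adv pol (Suc t)) h \<le> 1" for \<mu>
    by (rule round_step_le_1) (rule fair_prob_from_le_1)
  ultimately show ?case
    using 0(1)[of h] order_trans unfolding \<open>n = Suc n'\<close> fair_prob_from_Suc by fastforce
next
  case (Suc j)
  then obtain n' where n: "n = Suc n'" "j < n'" by (cases n) auto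
  let ?\<mu> = "\<lambda>t h x k. lin (\<beta> k) x + adv t h x k"
  have "fair_prob_from n K \<beta> D N adv pol t h \<le> round_step ?\<mu> t (fair_prob_from n' K \<beta> D N adv pol (Suc t)) h"
    unfolding n fair_prob_from_Suc by auto
  also have "\<dots> \<le> round_step ?\<mu> t (expect_from j ?\<mu> F (Suc t)) h"
    by (intro round_step_mono Suc.IH n) (use Suc.prems in auto)
  finally show ?case by simp
qed

section \<open>Change of measure along the process\<close>

text \<open>Given the history, the context and the arm have the same law on both sides, so averaging
  over them preserves the inequality. Only the noise integral changes measure, which replaces
  \<open>B\<close> by \<open>exp (\<Delta>\<^sup>2) * B\<close>.\<close>

lemma round_step_change_of_measure:
  assumes N: "N = std_normal" and \<mu>: "measurable_mean \<mu>" "measurable_mean \<mu>'"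
    and \<Phi>: "\<Phi> \<in> borel_measurable (hist_M (Suc t))" "\<Phi>' \<in> borel_measurable (hist_M (Suc t))"
    and h: "h \<in> space (hist_M t)"
    and le: "\<And>l h. l > 0 \<Longrightarrow> h \<in> space (hist_M (Suc t)) \<Longrightarrow> ennreal l * \<Phi>' h + 1 \<le> \<Phi> h + ennreal (l + B / (4 * l))"
    and l: "l > 0" and B: "B \<ge> 0" and \<Delta>: "\<And>x k. \<bar>\<mu> t h x k - \<mu>' t h x k\<bar> \<le> \<Delta>"
  shows "ennreal l * round_step \<mu>' t \<Phi>' h + 1 \<le> round_step \<mu> t \<Phi> h + ennreal (l + exp (\<Delta>\<^sup>2) * B / (4 * l))"
proof -
  let ?c = "l + exp (\<Delta>\<^sup>2) * B / (4 * l)"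
  define a where "a x k = (\<integral>\<^sup>+ e. \<Phi> (h(t := (x, k, \<mu> t h x k + e))) \<partial>N)" for x k
  define a' where "a' x k = (\<integral>\<^sup>+ e. \<Phi>' (h(t := (x, k, \<mu>' t h x k + e))) \<partial>N)" for x k
  let ?p = "\<lambda>x k. ennreal (pmf (pol t h x) k)"
  have m: "(\<lambda>x. ?p x k * a x k) \<in> borel_measurable D" "(\<lambda>x. ?p x k * a' x k) \<in> borel_measurable D" for k
    unfolding a_def a'_def by (intro inner_measurable_context \<mu> \<Phi> h)+
  have inner: "ennreal l * a' x k + 1 \<le> a x k + ennreal ?c" for x k
    unfolding a_def a'_def N
    using std_normal_change_of_measure[OF noise_measurable[OF \<Phi>(1) h] noise_measurable[OF \<Phi>(2) h] le[OF _ hist_upd_in_space[OF h]] l B \<Delta>]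
    by simp
  have "ennreal l * (\<Sum>k<K. ?p x k * a' x k) + 1 = (\<Sum>k<K. ?p x k * (ennreal l * a' x k + 1))" for x
    by (simp add: distrib_left sum.distrib sum_ennreal_pmf_eq_1 sum_distrib_left ac_simps)
  also have "(\<Sum>k<K. ?p x k * (ennreal l * a' x k + 1)) \<le> (\<Sum>k<K. ?p x k * (a x k + ennreal ?c))" for x
    by (intro sum_mono mult_left_mono inner) auto
  also have "(\<Sum>k<K. ?p x k * (a x k + ennreal ?c)) = (\<Sum>k<K. ?p x k * a x k) + ennreal ?c" for x
    by (simp add: distrib_left sum.distrib sum_ennreal_pmf_eq_1 flip: sum_distrib_right)
  finally have pw: "ennreal l * (\<Sum>k<K. ?p x k * a' x k) + 1 \<le> (\<Sum>k<K. ?p x k * a x k) + ennreal ?c" for x .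
  have "ennreal l * round_step \<mu>' t \<Phi>' h + 1 = (\<integral>\<^sup>+ x. ennreal l * (\<Sum>k<K. ?p x k * a' x k) + 1 \<partial>D)"
    unfolding round_step_def a'_def[symmetric]
    using m by (simp add: nn_integral_add nn_integral_cmult emeasure_space_eq_1 space_D)
  also have "\<dots> \<le> (\<integral>\<^sup>+ x. (\<Sum>k<K. ?p x k * a x k) + ennreal ?c \<partial>D)"
    by (intro nn_integral_mono pw)
  also have "\<dots> = round_step \<mu> t \<Phi> h + ennreal ?c"
    unfolding round_step_def a_def[symmetric]
    using m by (simp add: nn_integral_add emeasure_space_eq_1 space_D)
  finally show ?thesis .
qed

text \<open>In terms of \<open>1 - F\<close> this is \<open>E (1 - F) \<le> l * E' (1 - F) + exp (n
  * \<Delta>\<^sup>2) / (4 * l)\<close>, rearranged to avoid subtraction in \<open>ennreal\<close>.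
  Each round contributes a factor \<open>exp (\<Delta>\<^sup>2)\<close>; \<open>l\<close> is
  generalised in the induction because the step for one round rescales it pointwise.\<close>

lemma expect_from_change_of_measure:
  assumes N: "N = std_normal" and \<mu>: "measurable_mean \<mu>" "measurable_mean \<mu>'"
    and "F \<in> borel_measurable (hist_M (t + n))" and F1: "\<And>h. F h \<le> 1"
    and "h \<in> space (hist_M t)" and "l > 0"
    and "\<And>s h x k. s < t + n \<Longrightarrow> \<bar>\<mu> s h x k - \<mu>' s h x k\<bar> \<le> \<Delta>"
  shows "ennreal l * expect_from n \<mu>' F t h + 1
    \<le> expect_from n \<mu> F t h + ennreal (l + exp (real n * \<Delta>\<^sup>2) / (4 * l))"
  using assms(4,6-)
proof (induction n arbitrary: t h l)
  case 0
  have "F h \<noteq> \<top>" using F1[of h] by (auto simp: top_unique)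
  then obtain f where f: "F h = ennreal f" "f \<ge> 0" by (cases "F h") auto
  with F1[of h] have f1: "f \<le> 1" by simp
  \<comment> \<open>As \<open>1 - f\<close> lies in [0, 1], it suffices that
    \<open>1 - l \<le> 1 / (4 * l)\<close>, which is
    \<open>(2 * l - 1)\<^sup>2 \<ge> 0\<close>.\<close>
  have "l * f + 1 \<le> f + (l + 1 / (4 * l))"
  proof -
    have "1 - 1 / (4 * l) \<le> l"
    proof -
      have "0 \<le> (2 * l - 1)\<^sup>2 / (4 * l)" using \<open>l > 0\<close> by simp
      also have "\<dots> = l - 1 + 1 / (4 * l)" using \<open>l > 0\<close> by (simp add: field_simps power2_eq_square)
      finally show ?thesis by simp
    qed
    then have "(1 - f) * (1 - l) \<le> (1 - f) * (1 / (4 * l))" using f1 by (intro mult_left_mono) auto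
    also have "\<dots> \<le> 1 / (4 * l)" using f f1 \<open>l > 0\<close> by (intro mult_left_le_one_le) auto
    finally show ?thesis by (simp add: algebra_simps)
  qed
  then have "ennreal (l * f + 1) \<le> ennreal (f + (l + 1 / (4 * l)))" by (rule ennreal_leI)
  then show ?case using f \<open>l > 0\<close> by (simp add: ennreal_mult)
next
  case (Suc n)
  have "ennreal l * round_step \<mu>' t (expect_from n \<mu>' F (Suc t)) h + 1
     \<le> round_step \<mu> t (expect_from n \<mu> F (Suc t)) h + ennreal (l + exp (\<Delta>\<^sup>2) * exp (real n * \<Delta>\<^sup>2) / (4 * l))"
    by (rule round_step_change_of_measure[OF N \<mu>])
      (use Suc.prems in \<open>auto intro!: expect_from_measurable \<mu> Suc.IH simp del: ennreal_plus\<close>)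
  then show ?case by (simp add: algebra_simps flip: exp_add)
qed

section \<open>Regret as a sum over rounds\<close>

definition round_regret :: "(nat \<Rightarrow> real \<times> 'x) \<Rightarrow> nat \<Rightarrow> 'x hist \<Rightarrow> ennreal" where
  "round_regret \<beta> t h = (\<integral>\<^sup>+ x. (\<Sum>k<K. ennreal (pmf (pol t h x) k) *
     ennreal (best_val K \<beta> x - lin (\<beta> k) x)) \<partial>D)"

lemma best_val_measurable: "best_val K \<beta> \<in> borel_measurable borel"
proof -
  have "(\<lambda>x. Max ((\<lambda>j. lin (\<beta> j) x) ` {..<K})) \<in> borel_measurable borel"
    by (intro borel_measurable_Max) (auto simp: lin_def)
  moreover have "{lin (\<beta> j) x |j. j < K} = (\<lambda>j. lin (\<beta> j) x) ` {..<K}" for x by auto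
  ultimately show ?thesis unfolding best_val_def[abs_def] by simp
qed

text \<open>The first summand is paid by the regret of the current round, the others by the
  induction hypothesis under \<open>round_step\<close>, which is linear in this sum. The bound
  \<open>w s * F s\<close> allows a different event, tied to a different alternative, in each
  round.\<close>

lemma regret_from_ge_sum:
  fixes w :: "nat \<Rightarrow> ennreal"
  assumes \<mu>: "measurable_mean (\<lambda>t h x k. lin (\<beta> k) x + adv t h x k)"
    and F: "\<And>s. F s \<in> borel_measurable (hist_M s)"
    and r: "\<And>s h. h \<in> space (hist_M s) \<Longrightarrow> w s * F s h \<le> round_regret \<beta> s h"
    and h: "h \<in> space (hist_M t)"
  shows "(\<Sum>j<n. w (t + j) * expect_from j (\<lambda>t h x k. lin (\<beta> k) x + adv t h x k) (F (t + j)) t h)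
    \<le> regret_from n K \<beta> D N adv pol t h"
  using h
proof (induction n arbitrary: t h)
  case (Suc n)
  let ?\<mu> = "\<lambda>t h x k. lin (\<beta> k) x + adv t h x k"
  let ?E = "\<lambda>j. expect_from j ?\<mu> (F (Suc t + j)) (Suc t)"
  let ?p = "\<lambda>x k. ennreal (pmf (pol t h x) k)"
  let ?S = "\<lambda>h. \<Sum>j<n. w (Suc t + j) * ?E j h"
  have [measurable]: "(\<lambda>x. ?p x k) \<in> borel_measurable D" "best_val K \<beta> \<in> borel_measurable D"
    "lin (\<beta> k) \<in> borel_measurable D" for k
    using pmf_measurable_context[OF Suc.prems] best_val_measurable[of \<beta>]
    by (auto simp: measurable_cong_sets[OF sets_D refl] lin_def[abs_def])
  have E: "?E j \<in> borel_measurable (hist_M (Suc t))" for j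
    by (intro expect_from_measurable \<mu>) (use F in simp)
  have S: "?S \<in> borel_measurable (hist_M (Suc t))" using E by measurable
  note m = inner_measurable_context[OF \<mu> E Suc.prems]
  have step_sum: "round_step ?\<mu> t ?S h = (\<Sum>j<n. w (Suc t + j) * round_step ?\<mu> t (?E j) h)"
  proof -
    have N1: "(\<lambda>e. ?E j (h(t := (x, k, lin (\<beta> k) x + adv t h x k + e)))) \<in> borel_measurable N" for j x k
      using measurable_compose[OF _ noise_measurable[OF E Suc.prems], of "\<lambda>e. lin (\<beta> k) x + adv t h x k + e" N j x k]
      by (simp add: measurable_cong_sets[OF sets_N refl])
    have in_sum: "(\<integral>\<^sup>+ e. ?S (h(t := (x, k, lin (\<beta> k) x + adv t h x k + e))) \<partial>N)
      = (\<Sum>j<n. w (Suc t + j) * (\<integral>\<^sup>+ e. ?E j (h(t := (x, k, lin (\<beta> k) x + adv t h x k + e))) \<partial>N))" for x k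
      by (subst nn_integral_sum) (intro borel_measurable_times_ennreal borel_measurable_const N1 sum.cong nn_integral_cmult refl)+
    have "round_step ?\<mu> t ?S h = (\<integral>\<^sup>+ x. (\<Sum>j<n. w (Suc t + j) * (\<Sum>k<K. ?p x k * 
        (\<integral>\<^sup>+ e. ?E j (h(t := (x, k, lin (\<beta> k) x + adv t h x k + e))) \<partial>N))) \<partial>D)"
      unfolding round_step_def in_sum sum_distrib_left
      by (subst sum.swap) (simp only: mult.left_commute)
    also have "\<dots> = (\<Sum>j<n. w (Suc t + j) * round_step ?\<mu> t (?E j) h)"
      unfolding round_step_def using m by (simp add: nn_integral_sum nn_integral_cmult)
    finally show ?thesis .
  qed
  have "(\<Sum>j<Suc n. w (t + j) * expect_from j ?\<mu> (F (t + j)) t h)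
      = w t * F t h + (\<Sum>j<n. w (Suc t + j) * round_step ?\<mu> t (?E j) h)"
    by (subst sum.lessThan_Suc_shift) simp
  also have "\<dots> \<le> round_regret \<beta> t h + round_step ?\<mu> t ?S h"
    unfolding step_sum by (intro add_right_mono r Suc.prems)
  also have "\<dots> = (\<integral>\<^sup>+ x. (\<Sum>k<K. ?p x k * (ennreal (best_val K \<beta> x - lin (\<beta> k) x)
       + (\<integral>\<^sup>+ e. ?S (h(t := (x, k, lin (\<beta> k) x + adv t h x k + e))) \<partial>N))) \<partial>D)"
    unfolding round_regret_def round_step_def
    by (subst nn_integral_add[symmetric])
      (use inner_measurable_context[OF \<mu> S Suc.prems] in \<open>auto simp: distrib_left sum.distrib\<close>)
  also have "\<dots> \<le> regret_from (Suc n) K \<beta> D N adv pol t h"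
    unfolding regret_from.simps
    by (intro nn_integral_mono sum_mono mult_left_mono add_left_mono Suc.IH hist_upd_in_space Suc.prems) auto
  finally show ?case .
qed simp

end

section \<open>The hard instances\<close>

lemma nn_integral_lborel_translate:
  fixes c :: "'a::euclidean_space"
  assumes [measurable]: "f \<in> borel_measurable borel"
  shows "(\<integral>\<^sup>+ x. f (x + c) \<partial>lborel) = (\<integral>\<^sup>+ x. f x \<partial>lborel)"
proof -
  have "(\<integral>\<^sup>+ x. f x \<partial>lborel) = (\<integral>\<^sup>+ x. f x \<partial>distr lborel borel ((+) c))"
    by (simp add: lborel_distr_plus)
  also have "\<dots> = (\<integral>\<^sup>+ x. f (x + c) \<partial>lborel)"
    by (subst nn_integral_distr) (auto simp: add.commute)
  finally show ?thesis by simp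
qed

lemma inner_Basis_One: "b \<in> Basis \<Longrightarrow> One \<bullet> b = 1"
  by simp

lemma lin_measurable[measurable]: "lin v \<in> borel_measurable borel"
  by (simp add: lin_def[abs_def])

text \<open>An affine function is determined by its values at \<open>y\<close> and at the points
  \<open>y + w *\<^sub>R i\<close>: differences give the slope, then the value at \<open>y\<close>
  gives the intercept. The constants come from
  \<open>(a - b)\<^sup>2 \<le> 2 * a\<^sup>2 + 2 * b\<^sup>2\<close>.\<close>

lemma norm_sq_le_lin_samples:
  fixes v :: "real \<times> 'x::euclidean_space" and y :: 'x
  assumes w: "w > 0" and y: "norm y \<le> Y"
  defines "g \<equiv> (lin v y)\<^sup>2 + (\<Sum>i\<in>Basis. (lin v (y + w *\<^sub>R i))\<^sup>2)"
  shows "(norm v)\<^sup>2 \<le> (2 + (1 + 2 * Y\<^sup>2) * (2 * real (DIM('x) + 1) / w\<^sup>2)) * g"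
proof -
  let ?s = "snd v"
  have g0: "(lin v y)\<^sup>2 \<le> g" by (simp add: g_def sum_nonneg)
  have "w\<^sup>2 * (?s \<bullet> i)\<^sup>2 \<le> 2 * (lin v (y + w *\<^sub>R i))\<^sup>2 + 2 * (lin v y)\<^sup>2" for i
  proof -
    have "w * (?s \<bullet> i) = lin v (y + w *\<^sub>R i) - lin v y" by (simp add: lin_def inner_add_right)
    then have "w\<^sup>2 * (?s \<bullet> i)\<^sup>2 = (lin v (y + w *\<^sub>R i) - lin v y)\<^sup>2" by (metis power_mult_distrib)
    also have "\<dots> \<le> 2 * (lin v (y + w *\<^sub>R i))\<^sup>2 + 2 * (lin v y)\<^sup>2"
      using zero_le_power2[of "lin v (y + w *\<^sub>R i) + lin v y"] by (simp add: power2_eq_square algebra_simps)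
    finally show ?thesis .
  qed
  then have "(\<Sum>i\<in>Basis. w\<^sup>2 * (?s \<bullet> i)\<^sup>2) \<le> (\<Sum>i\<in>Basis. 2 * (lin v (y + w *\<^sub>R i))\<^sup>2 + 2 * (lin v y)\<^sup>2)"
    by (intro sum_mono)
  also have "\<dots> \<le> 2 * g + 2 * real (DIM('x)) * g"
  proof -
    have "(\<Sum>i\<in>Basis. (lin v (y + w *\<^sub>R i))\<^sup>2) \<le> g" by (simp add: g_def)
    moreover have "real (DIM('x)) * (2 * (lin v y)\<^sup>2) \<le> real (DIM('x)) * (2 * g)" by (intro mult_left_mono g0) simp_all
    ultimately show ?thesis
      unfolding sum.distrib sum_distrib_left[symmetric] sum_constant by linarith
  qed
  also have "(\<Sum>i\<in>Basis. w\<^sup>2 * (?s \<bullet> i)\<^sup>2) = w\<^sup>2 * (norm ?s)\<^sup>2"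
    by (simp add: norm_eq_sqrt_inner euclidean_inner[of ?s ?s] power2_eq_square sum_distrib_left sum_nonneg)
  finally have s: "(norm ?s)\<^sup>2 \<le> (2 * real (DIM('x) + 1) / w\<^sup>2) * g"
    using w by (simp add: field_simps)
  have "(fst v)\<^sup>2 \<le> 2 * (lin v y)\<^sup>2 + 2 * (?s \<bullet> y)\<^sup>2"
    using zero_le_power2[of "lin v y + ?s \<bullet> y"] by (simp add: lin_def power2_eq_square algebra_simps)
  also have "(?s \<bullet> y)\<^sup>2 \<le> (norm ?s)\<^sup>2 * Y\<^sup>2"
  proof -
    have "\<bar>?s \<bullet> y\<bar> \<le> norm ?s * Y"
      using Cauchy_Schwarz_ineq2[of ?s y] y by (meson mult_left_mono norm_ge_zero order_trans)
    from power_mono[OF this abs_ge_zero, of 2] show ?thesis by (simp add: power_mult_distrib)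
  qed
  finally have f: "(fst v)\<^sup>2 \<le> 2 * g + 2 * Y\<^sup>2 * (norm ?s)\<^sup>2" using g0 by (simp add: ac_simps)
  have "(norm v)\<^sup>2 = (fst v)\<^sup>2 + (norm ?s)\<^sup>2" by (simp add: norm_prod_def)
  also have "\<dots> \<le> 2 * g + (1 + 2 * Y\<^sup>2) * (norm ?s)\<^sup>2" using f by (simp add: algebra_simps)
  also have "\<dots> \<le> 2 * g + (1 + 2 * Y\<^sup>2) * ((2 * real (DIM('x) + 1) / w\<^sup>2) * g)"
    by (intro add_left_mono mult_left_mono s) (simp add: add_nonneg_nonneg)
  finally show ?thesis by (simp only: distrib_right mult.assoc)
qed

text \<open>Integrate the previous bound over a corner of the box whose translates by \<open>w *\<^sub>R i\<close>
  stay in the box.\<close>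

lemma lin_second_moment_box:
  fixes M w :: real
  assumes w: "w > 0"
  shows "\<exists>\<kappa>>0. \<forall>c::'x::euclidean_space. norm c \<le> M \<longrightarrow> (\<forall>v. ennreal (\<kappa> * (norm v)\<^sup>2)
    \<le> (\<integral>\<^sup>+ x. ennreal ((lin v x)\<^sup>2) * indicator (box (c - w *\<^sub>R One) (c + w *\<^sub>R One)) x \<partial>lborel))"
proof -
  let ?n = "real DIM('x)"
  \<comment> \<open>\<open>Y\<close> bounds the norm on the corner, whose points differ from
    \<open>c\<close> by at most \<open>w\<close> in each coordinate.\<close>
  define Y where "Y = M + ?n * w"
  define A where "A = 2 + (1 + 2 * Y\<^sup>2) * (2 * real (DIM('x) + 1) / w\<^sup>2)"
  have A: "A > 0" unfolding A_def using w by (intro add_pos_nonneg mult_nonneg_nonneg) auto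
  \<comment> \<open>The volume of the corner, divided by the constant \<open>A\<close> of the
    pointwise bound and by the number \<open>?n + 1\<close> of sample integrals, each at most the
    integral over the box. It does not depend on \<open>c\<close>, hence serves all arms at
    once.\<close>
  define \<kappa> where "\<kappa> = w ^ DIM('x) / (A * (?n + 1))"
  have "ennreal (\<kappa> * (norm v)\<^sup>2) \<le> (\<integral>\<^sup>+ x. ennreal ((lin v x)\<^sup>2) * indicator (box (c - w *\<^sub>R One) (c + w *\<^sub>R One)) x \<partial>lborel)"
    (is "_ \<le> ?I") if c: "norm c \<le> M" for c :: 'x and v
  proof -
    let ?B = "box (c - w *\<^sub>R One) (c + w *\<^sub>R One)" and ?S = "box (c - w *\<^sub>R One) c"
    let ?f = "\<lambda>x. ennreal ((lin v x)\<^sup>2)"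
    have S1: "?f y * indicator ?S y \<le> ?f y * indicator ?B y" for y
      using w by (intro mult_left_mono) (auto simp: box_def inner_simps split: split_indicator intro: less_le_trans order.strict_trans2)
    have S2: "?f (y + w *\<^sub>R i) * indicator ?S y \<le> ?f (y + w *\<^sub>R i) * indicator ?B (y + w *\<^sub>R i)" if i: "i \<in> Basis" for y i
    proof -
      have "y + w *\<^sub>R i \<in> ?B" if "y \<in> ?S"
        unfolding mem_box
      proof
        fix b :: 'x assume b: "b \<in> Basis"
        then have "(c - w *\<^sub>R One) \<bullet> b < y \<bullet> b" "y \<bullet> b < c \<bullet> b" using that by (auto simp: mem_box)
        moreover have "0 \<le> w * (i \<bullet> b)" "w * (i \<bullet> b) \<le> w" using i b w by (auto simp: inner_Basis)
        ultimately show "(c - w *\<^sub>R One) \<bullet> b < (y + w *\<^sub>R i) \<bullet> b \<and> (y + w *\<^sub>R i) \<bullet> b < (c + w *\<^sub>R One) \<bullet> b"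
          using inner_Basis_One[OF b] by (simp only: inner_simps mult_1_right) linarith
      qed
      then show ?thesis by (auto split: split_indicator)
    qed
    have pw: "ennreal ((norm v)\<^sup>2 / A) * indicator ?S y
        \<le> ?f y * indicator ?S y + (\<Sum>i\<in>Basis. ?f (y + w *\<^sub>R i) * indicator ?S y)" for y
    proof (cases "y \<in> ?S")
      case True
      have "norm y \<le> Y"
      proof -
        have "norm (y - c) \<le> (\<Sum>b\<in>Basis. \<bar>(y - c) \<bullet> b\<bar>)" by (rule norm_le_l1)
        also have "\<dots> \<le> (\<Sum>b\<in>(Basis::'x set). w)"
        proof (rule sum_mono)
          fix b :: 'x assume "b \<in> Basis"
          then show "\<bar>(y - c) \<bullet> b\<bar> \<le> w"
            using True by (auto simp: mem_box inner_simps dest!: bspec[of _ _ b])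
        qed
        finally have "norm (y - c) \<le> ?n * w" by simp
        then show ?thesis using c norm_triangle_ineq2[of y c] by (simp add: Y_def)
      qed
      from norm_sq_le_lin_samples[OF w this, of v]
      have "(norm v)\<^sup>2 / A \<le> (lin v y)\<^sup>2 + (\<Sum>i\<in>Basis. (lin v (y + w *\<^sub>R i))\<^sup>2)"
        using A by (simp add: A_def pos_divide_le_eq mult.commute)
      then have "ennreal ((norm v)\<^sup>2 / A) \<le> ennreal ((lin v y)\<^sup>2 + (\<Sum>i\<in>Basis. (lin v (y + w *\<^sub>R i))\<^sup>2))"
        by (rule ennreal_leI)
      then show ?thesis using True by (simp add: sum_nonneg sum_ennreal)
    qed simp
    have Sm: "emeasure lborel ?S = ennreal (w ^ DIM('x))"
      using w by (simp add: inner_simps)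
    have "ennreal ((norm v)\<^sup>2 / A) * ennreal (w ^ DIM('x)) = (\<integral>\<^sup>+ y. ennreal ((norm v)\<^sup>2 / A) * indicator ?S y \<partial>lborel)"
      by (simp add: nn_integral_cmult_indicator Sm del: emeasure_lborel_box)
    also have "\<dots> \<le> (\<integral>\<^sup>+ y. ?f y * indicator ?B y + (\<Sum>i\<in>Basis. ?f (y + w *\<^sub>R i) * indicator ?B (y + w *\<^sub>R i)) \<partial>lborel)"
      by (intro nn_integral_mono order_trans[OF pw] add_mono S1 sum_mono S2)
    also have "\<dots> = ?I + (\<Sum>i\<in>(Basis::'x set). ?I)"
      by (subst nn_integral_add, measurable, subst nn_integral_sum, measurable)
        (simp add: nn_integral_lborel_translate[of "\<lambda>x. ?f x * indicator ?B x"])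
    also have "\<dots> = ennreal (?n + 1) * ?I"
      by (simp add: distrib_right ennreal_of_nat_eq_real_of_nat add.commute)
    finally have "ennreal (1 / (?n + 1)) * (ennreal ((norm v)\<^sup>2 / A) * ennreal (w ^ DIM('x)))
       \<le> ennreal (1 / (?n + 1)) * (ennreal (?n + 1) * ?I)"
      by (intro mult_left_mono) auto
    also have "\<dots> = ?I" 
      by (simp flip: mult.assoc ennreal_mult del: ennreal_plus) 
    also have "ennreal (1 / (?n + 1)) * (ennreal ((norm v)\<^sup>2 / A) * ennreal (w ^ DIM('x))) = ennreal (\<kappa> * (norm v)\<^sup>2)"
      using A w by (simp add: \<kappa>_def field_simps flip: ennreal_mult del: ennreal_plus)
    finally show ?thesis .
  qed
  moreover have "\<kappa> > 0" unfolding \<kappa>_def using A w by simp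
  ultimately show ?thesis by blast
qed

section \<open>The instances: tangents of a parabola, uniform contexts on a cube\<close>

definition dir :: "'x::euclidean_space" where "dir = (SOME i. i \<in> Basis)"

lemma dir_Basis[simp]: "dir \<in> Basis"
  unfolding dir_def by (rule SOME_Basis)

text \<open>The mean rewards are the tangents of the parabola \<open>u\<^sup>2\<close> at the integers \<open>k\<close>, with
  \<open>u = x \<bullet> dir\<close>; hence every arm is strictly best near \<open>u = k\<close>, and raising arm \<open>0\<close> by \<open>\<rho>\<close>
  flips the order of the first two arms exactly for \<open>1 < 2 * u < 1 + \<rho>\<close>.\<close>

definition arms :: "real \<Rightarrow> nat \<Rightarrow> real \<times> 'x::euclidean_space" where
  "arms \<rho> k = ((if k = 0 then \<rho> else 0) - (real k)\<^sup>2, (2 * real k) *\<^sub>R dir)"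

lemma lin_arms: "lin (arms \<rho> k) x = (if k = 0 then \<rho> else 0) + 2 * real k * (x \<bullet> dir) - (real k)\<^sup>2"
  by (simp add: lin_def arms_def inner_commute)

text \<open>Half-side \<open>K\<close> leaves room for a neighbourhood of every tangent point
  \<open>u = k\<close> with \<open>k < K\<close>.\<close>

definition ctx_box :: "nat \<Rightarrow> 'x::euclidean_space set" where
  "ctx_box K = cbox (- real K *\<^sub>R One) (real K *\<^sub>R One)"

definition ctx_dist :: "nat \<Rightarrow> 'x::euclidean_space measure" where
  "ctx_dist K = uniform_measure lborel (ctx_box K)"

definition slab :: "nat \<Rightarrow> real \<Rightarrow> real \<Rightarrow> 'x::euclidean_space set" where
  "slab K a b = {x. \<forall>i\<in>Basis. if i = dir then a < x \<bullet> i \<and> x \<bullet> i < b else - real K < x \<bullet> i \<and> x \<bullet> i < real K}"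

lemma slab_box: "slab K a b = box (- real K *\<^sub>R One + (a + real K) *\<^sub>R dir) (real K *\<^sub>R One + (b - real K) *\<^sub>R dir)"
  by (auto simp: slab_def box_def inner_simps inner_Basis split: if_splits)

lemma emeasure_ctx_box: "emeasure lborel (ctx_box K :: 'x::euclidean_space set) = ennreal ((2 * real K) ^ DIM('x))"
  unfolding ctx_box_def by (subst emeasure_lborel_cbox) (auto simp: inner_simps)

lemma emeasure_slab:
  assumes "a \<le> b"
  shows "emeasure lborel (slab K a b :: 'x::euclidean_space set) = ennreal ((b - a) * (2 * real K) ^ (DIM('x) - 1))"
proof -
  have "emeasure lborel (slab K a b :: 'x set) = ennreal (\<Prod>i\<in>(Basis::'x set). if i = dir then b - a else 2 * real K)"
    unfolding slab_box using assms
    by (subst emeasure_lborel_box) (auto simp: inner_simps inner_Basis intro!: arg_cong[where f = ennreal] prod.cong)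
  also have "(\<Prod>i\<in>(Basis::'x set). if i = dir then b - a else 2 * real K) = (b - a) * (2 * real K) ^ (DIM('x) - 1)"
    by (subst prod.remove[of _ dir]) (auto simp: prod.If_cases card_Diff_singleton Int_absorb2)
  finally show ?thesis .
qed

lemma slab_measurable[measurable]: "slab K a b \<in> sets borel"
  unfolding slab_box by simp

lemma ctx_box_sets[measurable]: "(ctx_box K :: 'x::euclidean_space set) \<in> sets borel"
  by (simp add: ctx_box_def)

lemma sets_ctx_dist: "sets (ctx_dist K :: 'x::euclidean_space measure) = sets borel"
  by (simp add: ctx_dist_def)

text \<open>With \<open>d = k - j\<close> the gap equals \<open>d\<^sup>2 + 2 * (u - k) * d\<close>,
  which is at least \<open>\<bar>d\<bar> - \<bar>d\<bar> / 2\<close>, and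
  \<open>\<bar>d\<bar> \<ge> 1\<close> for distinct integers.\<close>

lemma tangent_gap:
  assumes "j \<noteq> k" "\<bar>u - real k\<bar> \<le> 1 / 4"
  shows "2 * real k * u - (real k)\<^sup>2 - (2 * real j * u - (real j)\<^sup>2) \<ge> 1 / 2"
proof -
  define d where "d = real k - real j"
  have d: "\<bar>d\<bar> \<ge> 1" using assms(1) unfolding d_def by linarith
  have "2 * real k * u - (real k)\<^sup>2 - (2 * real j * u - (real j)\<^sup>2) = d * d + 2 * (u - real k) * d"
    by (simp add: d_def power2_eq_square algebra_simps)
  also have "2 * (u - real k) * d \<ge> - (1 / 2 * \<bar>d\<bar>)"
  proof -
    have "\<bar>2 * (u - real k) * d\<bar> \<le> 1 / 2 * \<bar>d\<bar>"
      unfolding abs_mult using assms(2) by (intro mult_right_mono) auto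
    then show ?thesis by linarith
  qed
  moreover have "d * d \<ge> \<bar>d\<bar>" using mult_right_mono[OF d, of "\<bar>d\<bar>"] by (simp flip: abs_mult)
  ultimately show ?thesis using d by linarith
qed

text \<open>The tangents are \<open>1 / 2\<close> apart here; raising arm 0 by
  \<open>\<rho> \<le> 1 / 4\<close> leaves at least \<open>1 / 4\<close>, more than the margin
  \<open>1 / 8\<close>.\<close>

lemma box_subset_Q_set:
  assumes \<rho>: "0 \<le> \<rho>" "\<rho> \<le> 1 / 4"
  shows "box (real k *\<^sub>R dir - (1 / 4) *\<^sub>R One) (real k *\<^sub>R dir + (1 / 4) *\<^sub>R One) \<subseteq> Q_set K (arms \<rho> :: nat \<Rightarrow> real \<times> 'x::euclidean_space) (1 / 8) k"
proof
  fix x :: 'x assume "x \<in> box (real k *\<^sub>R dir - (1 / 4) *\<^sub>R One) (real k *\<^sub>R dir + (1 / 4) *\<^sub>R One)"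
  then have "real k - 1 / 4 < x \<bullet> dir \<and> x \<bullet> dir < real k + 1 / 4"
    by (auto simp: mem_box inner_simps dest!: bspec[OF _ dir_Basis])
  then have u: "\<bar>x \<bullet> dir - real k\<bar> \<le> 1 / 4" by linarith
  show "x \<in> Q_set K (arms \<rho>) (1 / 8) k"
    unfolding Q_set_def mem_Collect_eq
  proof (intro allI impI)
    fix j assume "j \<noteq> k"
    from tangent_gap[OF this u] \<rho> show "lin (arms \<rho> j) x + 1 / 8 < lin (arms \<rho> k) x"
      unfolding lin_arms by (cases "j = 0"; cases "k = 0") simp_all
  qed
qed

lemma Q_set_measurable[measurable]: "Q_set K (\<beta> :: nat \<Rightarrow> real \<times> 'x::euclidean_space) c k \<in> sets borel"
proof -
  have "Q_set K \<beta> c k = {x \<in> space borel. \<forall>j\<in>{..<K}. j \<noteq> k \<longrightarrow> lin (\<beta> k) x > lin (\<beta> j) x + c}"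
    by (auto simp: Q_set_def)
  also have "\<dots> \<in> sets borel" by measurable
  finally show ?thesis .
qed

text \<open>Exponential tilting of the standard normal gives the normal law with mean
  \<open>l\<close>, so the sub-Gaussian bound holds with equality. The factor
  \<open>1\<^sup>2\<close> matches \<open>problem_instance\<close> at noise level 1.\<close>

lemma std_normal_mgf:
  "integrable std_normal (\<lambda>e. exp (l * e)) \<and> (\<integral>e. exp (l * e) \<partial>std_normal) \<le> exp (l\<^sup>2 * 1\<^sup>2 / 2)"
proof -
  have eq: "std_normal_density e * exp (l * e) = exp (l\<^sup>2 / 2) * normal_density l 1 e" for e
  proof -
    have "- e\<^sup>2 / 2 + l * e = l\<^sup>2 / 2 + (- (e - l)\<^sup>2 / 2)" by (simp add: power2_eq_square field_simps)
    then have "exp (- e\<^sup>2 / 2) * exp (l * e) = exp (l\<^sup>2 / 2) * exp (- (e - l)\<^sup>2 / 2)"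
      by (metis exp_add)
    then show ?thesis by (simp add: normal_density_def)
  qed
  have "integrable lborel (\<lambda>e. std_normal_density e * exp (l * e))" unfolding eq by simp
  moreover have "(\<integral>e. std_normal_density e * exp (l * e) \<partial>lborel) = exp (l\<^sup>2 / 2)" unfolding eq by simp
  ultimately show ?thesis
    by (simp add: integrable_density integral_density)
qed

section \<open>Assumptions A1-A3 for the instances\<close>

context
  fixes K :: nat assumes K: "K \<ge> 2"
begin

lemma emeasure_ctx_box_pos: "emeasure lborel (ctx_box K :: 'x::euclidean_space set) \<noteq> 0"
    "emeasure lborel (ctx_box K :: 'x::euclidean_space set) \<noteq> \<infinity>"
  using K by (auto simp: emeasure_ctx_box)

lemma prob_space_ctx_dist: "prob_space (ctx_dist K :: 'x::euclidean_space measure)"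
  unfolding ctx_dist_def by (rule prob_space_uniform_measure[OF emeasure_ctx_box_pos])

lemma emeasure_ctx_dist:
  "A \<in> sets borel \<Longrightarrow> emeasure (ctx_dist K :: 'x::euclidean_space measure) A
     = emeasure lborel (ctx_box K \<inter> A) / ennreal ((2 * real K) ^ DIM('x))"
  unfolding ctx_dist_def by (subst emeasure_uniform_measure) (auto simp: emeasure_ctx_box)

lemma box_power_divide: "c * (2 * real K) ^ (DIM('x::euclidean_space) - 1) / (2 * real K) ^ DIM('x) = c / (2 * real K)"
proof -
  have "(2 * real K) ^ DIM('x) = 2 * real K * (2 * real K) ^ (DIM('x) - 1)"
    by (simp only: power_Suc[symmetric]) simp
  then show ?thesis using K by (simp only:) simp
qed

lemma slab_subset_ctx_box:
  assumes "- real K \<le> a" "b \<le> real K"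
  shows "(slab K a b :: 'x::euclidean_space set) \<subseteq> box (- real K *\<^sub>R One) (real K *\<^sub>R One)"
  using assms by (force simp: slab_def mem_box inner_simps split: if_splits)

lemma emeasure_ctx_dist_slab:
  assumes "- real K \<le> a" "a \<le> b" "b \<le> real K"
  shows "emeasure (ctx_dist K) (slab K a b :: 'x::euclidean_space set) = ennreal ((b - a) / (2 * real K))"
proof -
  have "ctx_box K \<inter> slab K a b = (slab K a b :: 'x set)"
    using slab_subset_ctx_box[OF assms(1,3)] box_subset_cbox unfolding ctx_box_def by blast
  then have "emeasure (ctx_dist K) (slab K a b :: 'x set)
      = ennreal ((b - a) * (2 * real K) ^ (DIM('x) - 1)) / ennreal ((2 * real K) ^ DIM('x))"
    by (simp only: emeasure_ctx_dist slab_measurable emeasure_slab[OF assms(2)])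
  also have "\<dots> = ennreal ((b - a) * (2 * real K) ^ (DIM('x) - 1) / (2 * real K) ^ DIM('x))"
    using K assms(2) by (intro divide_ennreal) auto
  finally show ?thesis by (simp only: box_power_divide)
qed

text \<open>The strip may stick out of the cube, so it is compared with a full slab of width
  \<open>2 * w\<close>, of relative volume \<open>w / K\<close>. This yields A2 with
  \<open>L = 1\<close>.\<close>

lemma measure_ctx_dist_strip:
  assumes "w \<ge> 0"
  shows "measure (ctx_dist K) {x :: 'x::euclidean_space. \<bar>x \<bullet> dir - u\<bar> \<le> w} \<le> w"
proof -
  let ?A = "{x :: 'x. \<bar>x \<bullet> dir - u\<bar> \<le> w}"
  let ?l = "- real K *\<^sub>R One + (u - w + real K) *\<^sub>R dir" and ?u = "real K *\<^sub>R One + (u + w - real K) *\<^sub>R dir :: 'x"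
  have "emeasure lborel (ctx_box K \<inter> ?A) \<le> emeasure lborel (cbox ?l ?u)"
    by (intro emeasure_mono) (auto simp: ctx_box_def mem_box inner_simps inner_Basis abs_le_iff)
  also have "\<dots> = emeasure lborel (slab K (u - w) (u + w) :: 'x set)"
    unfolding slab_box using assms
    by (subst emeasure_lborel_cbox, force simp: inner_simps inner_Basis)
      (subst emeasure_lborel_box, auto simp: inner_simps inner_Basis)
  also have "\<dots> = ennreal (2 * w * (2 * real K) ^ (DIM('x) - 1))"
    using assms by (subst emeasure_slab) auto
  finally have "emeasure (ctx_dist K) ?A \<le> ennreal (2 * w * (2 * real K) ^ (DIM('x) - 1)) / ennreal ((2 * real K) ^ DIM('x))"
    by (subst emeasure_ctx_dist) (auto intro: divide_right_mono_ennreal)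
  also have "\<dots> = ennreal (2 * w * (2 * real K) ^ (DIM('x) - 1) / (2 * real K) ^ DIM('x))"
    using K assms by (intro divide_ennreal) auto
  also have "\<dots> = ennreal (w / real K)" by (simp only: box_power_divide) simp
  also have "\<dots> \<le> ennreal w"
    using K assms by (intro ennreal_leI) (simp add: divide_le_eq mult_le_cancel_left1)
  finally show ?thesis
    using assms by (simp add: measure_def enn2real_leI)
qed

lemma ctx_support_subset: "ctx_support (ctx_dist K :: 'x::euclidean_space measure) \<subseteq> {x. \<forall>i\<in>Basis. \<bar>x \<bullet> i\<bar> \<le> real K}"
proof
  fix x :: 'x assume x: "x \<in> ctx_support (ctx_dist K)"
  have "x \<in> ctx_box K"
  proof (rule ccontr)
    assume "x \<notin> ctx_box K"
    then have "x \<in> - ctx_box K" "open (- ctx_box K :: 'x set)" by (auto simp: ctx_box_def)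
    then obtain e where e: "e > 0" "ball x e \<subseteq> - ctx_box K" by (meson open_contains_ball)
    then have "ctx_box K \<inter> ball x e = {}" by blast
    then have "emeasure (ctx_dist K) (ball x e) = 0" by (simp add: emeasure_ctx_dist)
    with x e show False by (auto simp: ctx_support_def)
  qed
  then show "x \<in> {x. \<forall>i\<in>Basis. \<bar>x \<bullet> i\<bar> \<le> real K}"
    by (auto simp: ctx_box_def mem_box inner_simps abs_le_iff)
qed

text \<open>Fairness is demanded only at support points; this inclusion makes it apply to the region
  on which the two instances disagree.\<close>

lemma box_subset_ctx_support: "box (- real K *\<^sub>R One) (real K *\<^sub>R One) \<subseteq> ctx_support (ctx_dist K :: 'x::euclidean_space measure)"
proof
  fix x :: 'x assume x: "x \<in> box (- real K *\<^sub>R One) (real K *\<^sub>R One)"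
  have "emeasure (ctx_dist K) (ball x e) > 0" if "e > 0" for e
  proof -
    let ?U = "ball x e \<inter> box (- real K *\<^sub>R One) (real K *\<^sub>R One)"
    have "x \<in> ?U" using x that by simp
    then have "open ?U" "?U \<noteq> {}" by blast+
    then have "\<not> negligible ?U" by (rule open_not_negligible)
    then have "emeasure lborel ?U \<noteq> 0"
      by (simp add: negligible_iff_null_sets null_sets_def)
    moreover have "?U \<subseteq> ctx_box K \<inter> ball x e"
      using box_subset_cbox unfolding ctx_box_def by blast
    then have "emeasure lborel ?U \<le> emeasure lborel (ctx_box K \<inter> ball x e)"
      by (intro emeasure_mono) auto
    ultimately have "emeasure lborel (ctx_box K \<inter> ball x e) > 0" by (metis le_zero_eq zero_less_iff_neq_zero)
    then show ?thesis
      by (simp add: emeasure_ctx_dist ennreal_zero_less_divide)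
  qed
  then show "x \<in> ctx_support (ctx_dist K)" by (simp add: ctx_support_def)
qed

lemma box_subset_ctx_box:
  assumes "k < K"
  shows "box (real k *\<^sub>R dir - (1 / 4) *\<^sub>R One) (real k *\<^sub>R dir + (1 / 4) *\<^sub>R One) \<subseteq> (ctx_box K :: 'x::euclidean_space set)"
proof
  fix x :: 'x assume x: "x \<in> box (real k *\<^sub>R dir - (1 / 4) *\<^sub>R One) (real k *\<^sub>R dir + (1 / 4) *\<^sub>R One)"
  show "x \<in> ctx_box K"
    unfolding ctx_box_def mem_box
  proof
    fix i :: 'x assume i: "i \<in> Basis"
    have "real k + 1 \<le> real K" using assms by linarith
    with i x show "(- real K *\<^sub>R One) \<bullet> i \<le> x \<bullet> i \<and> x \<bullet> i \<le> (real K *\<^sub>R One) \<bullet> i"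
      by (force simp: mem_box inner_simps inner_Basis split: if_splits dest!: bspec[OF _ i])
  qed
qed

lemma measure_Q_set_ge:
  assumes \<rho>: "0 \<le> \<rho>" "\<rho> \<le> 1 / 4" and k: "k < K"
  shows "measure (ctx_dist K) (Q_set K (arms \<rho> :: nat \<Rightarrow> real \<times> 'x::euclidean_space) (1 / 8) k)
    \<ge> (1 / (4 * real K)) ^ DIM('x)"
proof -
  let ?B = "box (real k *\<^sub>R dir - (1 / 4) *\<^sub>R One) (real k *\<^sub>R dir + (1 / 4) *\<^sub>R One) :: 'x set"
  interpret prob_space "ctx_dist K :: 'x measure" by (rule prob_space_ctx_dist)
  have "emeasure (ctx_dist K) ?B = ennreal ((1 / 2) ^ DIM('x)) / ennreal ((2 * real K) ^ DIM('x))"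
    using box_subset_ctx_box[OF k, where 'x = 'x] by (simp add: emeasure_ctx_dist Int_absorb1 inner_simps)
  also have "\<dots> = ennreal ((1 / (4 * real K)) ^ DIM('x))"
  proof -
    have "(1 / 2) ^ DIM('x) / (2 * real K) ^ DIM('x) = (1 / 2 / (2 * real K)) ^ DIM('x)"
      by (simp only: power_divide)
    then show ?thesis using K by (subst divide_ennreal) (simp_all only:, simp_all)
  qed
  finally have "measure (ctx_dist K) ?B = (1 / (4 * real K)) ^ DIM('x)"
    by (simp add: measure_def)
  moreover have "measure (ctx_dist K) ?B \<le> measure (ctx_dist K) (Q_set K (arms \<rho> :: nat \<Rightarrow> real \<times> 'x) (1 / 8) k)"
    by (rule finite_measure_mono[OF box_subset_Q_set[OF \<rho>]]) (simp add: sets_ctx_dist)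
  ultimately show ?thesis by simp
qed

text \<open>The set contains a cube of side \<open>1 / 2\<close> around
  \<open>real k *\<^sub>R dir\<close>, whose norm is at most \<open>K\<close>, so one
  \<open>\<kappa>\<close> serves all \<open>k\<close> and \<open>\<rho>\<close>. Dividing by the
  probability of the set, at most 1, can only increase the bound.\<close>

lemma lin_second_moment_Q_set:
  "\<exists>lam>0. \<forall>\<rho> k v. 0 \<le> \<rho> \<longrightarrow> \<rho> \<le> 1 / 4 \<longrightarrow> k < K \<longrightarrow>
     (LINT x:Q_set K (arms \<rho>) (1 / 8) k|ctx_dist K. (lin (v :: real \<times> 'x::euclidean_space) x)\<^sup>2) /
       measure (ctx_dist K) (Q_set K (arms \<rho> :: nat \<Rightarrow> real \<times> 'x) (1 / 8) k) \<ge> lam * (norm v)\<^sup>2"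
proof -
  let ?V = "(2 * real K) ^ DIM('x)"
  have V: "?V > 0" using K by simp
  obtain \<kappa> where \<kappa>: "\<kappa> > 0" "\<And>c v. norm (c::'x) \<le> real K \<Longrightarrow> ennreal (\<kappa> * (norm v)\<^sup>2)
    \<le> (\<integral>\<^sup>+ x. ennreal ((lin v x)\<^sup>2) * indicator (box (c - (1 / 4) *\<^sub>R One) (c + (1 / 4) *\<^sub>R One)) x \<partial>lborel)"
    using lin_second_moment_box[of "1 / 4" "real K", where 'x = 'x] by auto
  interpret D: prob_space "ctx_dist K :: 'x measure" by (rule prob_space_ctx_dist)
  have "(LINT x:Q_set K (arms \<rho>) (1 / 8) k|ctx_dist K. (lin v x)\<^sup>2) /
       measure (ctx_dist K) (Q_set K (arms \<rho> :: nat \<Rightarrow> real \<times> 'x) (1 / 8) k) \<ge> \<kappa> / ?V * (norm v)\<^sup>2"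
    if \<rho>: "0 \<le> \<rho>" "\<rho> \<le> 1 / 4" and k: "k < K" for \<rho> k and v :: "real \<times> 'x"
  proof -
    let ?Q = "Q_set K (arms \<rho> :: nat \<Rightarrow> real \<times> 'x) (1 / 8) k"
    let ?B = "box (real k *\<^sub>R dir - (1 / 4) *\<^sub>R One) (real k *\<^sub>R dir + (1 / 4) *\<^sub>R One) :: 'x set"
    let ?f = "\<lambda>x. (lin v x)\<^sup>2"
    have [measurable]: "?f \<in> borel_measurable borel" by measurable
    have "bounded (?f ` ctx_box K)"
      unfolding ctx_box_def lin_def by (intro compact_imp_bounded compact_continuous_image continuous_intros) auto
    then obtain b where b: "\<And>x. x \<in> ctx_box K \<Longrightarrow> ?f x \<le> b"
      by (auto simp: bounded_iff)
    have int: "integrable (ctx_dist K) (\<lambda>x. indicator ?Q x *\<^sub>R ?f x)"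
    proof (rule D.integrable_const_bound)
      show "AE x in ctx_dist K. norm (indicator ?Q x *\<^sub>R ?f x) \<le> \<bar>b\<bar>"
        unfolding ctx_dist_def
        by (rule AE_uniform_measureI) (use b in \<open>force intro!: AE_I2 split: split_indicator\<close>)+
      show "(\<lambda>x. indicator ?Q x *\<^sub>R ?f x) \<in> borel_measurable (ctx_dist K)"
        unfolding measurable_cong_sets[OF sets_ctx_dist refl] by measurable
    qed
    have "norm (real k *\<^sub>R dir :: 'x) \<le> real K" using k by simp
    from \<kappa>(2)[OF this, of v]
    have "ennreal (\<kappa> * (norm v)\<^sup>2) / ennreal ?V \<le> (\<integral>\<^sup>+ x. ennreal (?f x) * indicator ?B x \<partial>lborel) / ennreal ?V"
      by (rule divide_right_mono_ennreal)
    also have "\<dots> \<le> (\<integral>\<^sup>+ x. ennreal (indicator ?Q x *\<^sub>R ?f x) * indicator (ctx_box K) x \<partial>lborel) / ennreal ?V"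
      using box_subset_Q_set[OF \<rho>, of k, where 'x = 'x] box_subset_ctx_box[OF k, where 'x = 'x]
      by (intro divide_right_mono_ennreal nn_integral_mono) (auto split: split_indicator)
    also have "\<dots> = (\<integral>\<^sup>+ x. ennreal (indicator ?Q x *\<^sub>R ?f x) \<partial>ctx_dist K)"
      unfolding ctx_dist_def by (subst nn_integral_uniform_measure) (auto simp: emeasure_ctx_box)
    also have "\<dots> = ennreal (LINT x:?Q|ctx_dist K. ?f x)"
      unfolding set_lebesgue_integral_def by (intro nn_integral_eq_integral int AE_I2) auto
    finally have "ennreal (\<kappa> / ?V * (norm v)\<^sup>2) \<le> ennreal (LINT x:?Q|ctx_dist K. ?f x)"
      using V \<kappa>(1) by (simp add: divide_ennreal)
    then have "\<kappa> / ?V * (norm v)\<^sup>2 \<le> (LINT x:?Q|ctx_dist K. ?f x)"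
      by (subst (asm) ennreal_le_iff) (auto simp: set_lebesgue_integral_def intro!: integral_nonneg_AE)
    also have "\<dots> \<le> (LINT x:?Q|ctx_dist K. ?f x) / measure (ctx_dist K) ?Q"
    proof -
      have "measure (ctx_dist K) ?Q > 0"
        by (rule less_le_trans[OF _ measure_Q_set_ge[OF \<rho> k]]) (use K in simp)
      moreover have "(LINT x:?Q|ctx_dist K. ?f x) \<ge> 0"
        by (auto simp: set_lebesgue_integral_def intro!: integral_nonneg_AE)
      ultimately show ?thesis
        using D.prob_le_1[of ?Q] by (simp add: pos_le_divide_eq mult_left_le)
    qed
    finally show ?thesis .
  qed
  moreover have "\<kappa> / ?V > 0" using \<kappa> V by simp
  ultimately show ?thesis by blast
qed

text \<open>The difference of two arms is \<open>2 * d * (u - u0)\<close> with an integer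
  \<open>d \<noteq> 0\<close>, so a difference of at most \<open>w\<close> confines \<open>u\<close>
  to a strip of half-width \<open>w\<close>.\<close>

lemma margin_condition:
  assumes "i \<noteq> j" "w > 0"
  shows "measure (ctx_dist K) {x. 0 < \<bar>lin (arms \<rho> i) x - lin (arms \<rho> j :: real \<times> 'x::euclidean_space) x\<bar> \<and>
    \<bar>lin (arms \<rho> i) x - lin (arms \<rho> j) x\<bar> \<le> w} \<le> w"
proof -
  define d where "d = real i - real j"
  have d: "\<bar>d\<bar> \<ge> 1" using assms(1) unfolding d_def by linarith
  define c where "c = lin (arms \<rho> i) (0::'x) - lin (arms \<rho> j) (0::'x)"
  have eq: "lin (arms \<rho> i) x - lin (arms \<rho> j) x = 2 * d * (x \<bullet> dir - (- c / (2 * d)))" for x :: 'x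
    using d by (simp add: lin_arms c_def d_def field_simps)
  have "\<bar>x \<bullet> dir - (- c / (2 * d))\<bar> \<le> w" if "\<bar>lin (arms \<rho> i) x - lin (arms \<rho> j) x\<bar> \<le> w" for x :: 'x
  proof -
    have "1 * \<bar>x \<bullet> dir - (- c / (2 * d))\<bar> \<le> \<bar>2 * d\<bar> * \<bar>x \<bullet> dir - (- c / (2 * d))\<bar>"
      by (rule mult_right_mono) (use d in auto)
    also have "\<dots> = \<bar>lin (arms \<rho> i) x - lin (arms \<rho> j) x\<bar>" by (simp only: eq abs_mult)
    also note that
    finally show ?thesis by simp
  qed
  then have "measure (ctx_dist K) {x. 0 < \<bar>lin (arms \<rho> i) x - lin (arms \<rho> j :: real \<times> 'x) x\<bar> \<and>
      \<bar>lin (arms \<rho> i) x - lin (arms \<rho> j) x\<bar> \<le> w}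
    \<le> measure (ctx_dist K) {x :: 'x. \<bar>x \<bullet> dir - (- c / (2 * d))\<bar> \<le> w}"
    by (intro finite_measure.finite_measure_mono prob_space.finite_measure[OF prob_space_ctx_dist]) (auto simp: sets_ctx_dist)
  also have "\<dots> \<le> w" by (rule measure_ctx_dist_strip) (use assms in simp)
  finally show ?thesis .
qed

text \<open>\<open>lam\<close> is chosen before \<open>\<rho>\<close>: the policy has to be fair on
  all these instances at once, so they must lie in one class with common constants.\<close>

lemma problem_instance_arms:
  "\<exists>lam>0. \<forall>\<rho>. 0 \<le> \<rho> \<longrightarrow> \<rho> \<le> 1 / 4 \<longrightarrow>
    problem_instance K (real K) ((real K)\<^sup>2 + 2 * real K + 1) 1 (1 / 8) ((1 / (4 * real K)) ^ DIM('x)) lam 1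
      (ctx_dist K :: 'x::euclidean_space measure) (arms \<rho>) std_normal"
proof -
  obtain lam where lam: "lam > 0" "\<And>\<rho> k v. 0 \<le> \<rho> \<Longrightarrow> \<rho> \<le> 1 / 4 \<Longrightarrow> k < K \<Longrightarrow>
     (LINT x:Q_set K (arms \<rho>) (1 / 8) k|ctx_dist K. (lin (v :: real \<times> 'x) x)\<^sup>2) /
       measure (ctx_dist K) (Q_set K (arms \<rho> :: nat \<Rightarrow> real \<times> 'x) (1 / 8) k) \<ge> lam * (norm v)\<^sup>2"
    using lin_second_moment_Q_set[where 'x = 'x] by blast
  have nrm: "norm (arms \<rho> k :: real \<times> 'x) \<le> (real K)\<^sup>2 + 2 * real K + 1" if "0 \<le> \<rho>" "\<rho> \<le> 1 / 4" "k < K" for \<rho> k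
  proof -
    have "norm (arms \<rho> k :: real \<times> 'x) \<le> \<bar>(if k = 0 then \<rho> else 0) - (real k)\<^sup>2\<bar> + 2 * real k"
      unfolding arms_def by (rule order_trans[OF norm_Pair_le]) simp
    also have "\<bar>(if k = 0 then \<rho> else 0) - (real k)\<^sup>2\<bar> \<le> 1 + (real k)\<^sup>2" using that by auto
    also have "(real k)\<^sup>2 \<le> (real K)\<^sup>2" using that by (intro power_mono) auto
    finally show ?thesis using that by simp
  qed
  have "\<exists>p. p \<in> borel_measurable lborel \<and> (ctx_dist K :: 'x measure) = density lborel p"
    unfolding ctx_dist_def uniform_measure_def by (rule exI, rule conjI[OF _ refl]) measurable
  then have "problem_instance K (real K) ((real K)\<^sup>2 + 2 * real K + 1) 1 (1 / 8) ((1 / (4 * real K)) ^ DIM('x)) lam 1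
      (ctx_dist K :: 'x measure) (arms \<rho>) std_normal" if "0 \<le> \<rho>" "\<rho> \<le> 1 / 4" for \<rho>
    unfolding problem_instance_def mult_1
    by (intro conjI allI impI prob_space_ctx_dist sets_ctx_dist ctx_support_subset nrm margin_condition
        measure_Q_set_ge lam(2) that prob_space_normal_density std_normal_mgf[THEN conjunct1] std_normal_mgf[THEN conjunct2])
      simp_all
  with lam(1) show ?thesis by blast
qed

end

section \<open>Regret forced by fairness\<close>

context bandit_process
begin

text \<open>The fairness event quantifies over uncountably many contexts and need not be measurable;
  its almost-everywhere version on a region is.\<close>

definition no_pref :: "'x set \<Rightarrow> nat \<Rightarrow> 'x hist \<Rightarrow> ennreal" where
  "no_pref R t h =
    (if (\<integral>\<^sup>+ x. indicator R x * (if pmf (pol t h x) 0 < pmf (pol t h x) 1 then 1 else 0) \<partial>D) = 0 then 1 else 0)"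

lemma no_pref_le_1: "no_pref R t h \<le> 1"
  by (simp add: no_pref_def)

lemma no_pref_measurable:
  assumes [measurable]: "R \<in> sets borel"
  shows "no_pref R t \<in> borel_measurable (hist_M t)"
proof -
  have s[measurable]: "snd \<in> hist_M t \<Otimes>\<^sub>M D \<rightarrow>\<^sub>M borel"
    using measurable_snd[of "hist_M t" D] by (simp add: measurable_cong_sets[OF refl sets_D])
  have [measurable]: "(\<lambda>p. pmf (pol t (fst p) (snd p)) k) \<in> borel_measurable (hist_M t \<Otimes>\<^sub>M D)" for k
    by (rule pmf_measurable_comp[OF measurable_fst s])
  have [measurable]: "(\<lambda>h. \<integral>\<^sup>+ x. indicator R x * (if pmf (pol t h x) 0 < pmf (pol t h x) 1 then 1 else 0) \<partial>D)
      \<in> borel_measurable (hist_M t)"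
    by (rule sigma_finite_measure.borel_measurable_nn_integral[OF sigma_finite_D])
      (simp add: case_prod_beta')
  show ?thesis unfolding no_pref_def[abs_def] by measurable
qed

lemma no_pref_fair_round:
  assumes "R \<subseteq> ctx_support D" "1 < K" "\<And>x. x \<in> R \<Longrightarrow> lin (\<beta> 1) x \<le> lin (\<beta> 0) x"
    and "fair_round K \<beta> D pol t h"
  shows "no_pref R t h \<ge> 1"
proof -
  have eq: "indicator R x * (if pmf (pol t h x) 0 < pmf (pol t h x) 1 then 1 else 0) = (0::ennreal)" for x
    using assms by (force simp: fair_round_def split: split_indicator)
  show ?thesis unfolding no_pref_def eq by simp
qed

text \<open>Where arm 1 is not preferred to arm 0, it has probability at most \<open>1 / 2\<close>,
  and every other arm costs at least \<open>g\<close>.\<close>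

lemma round_regret_ge_no_pref:
  assumes R[measurable]: "R \<in> sets borel" and h: "h \<in> space (hist_M t)" and K: "1 < K" and g: "g \<ge> 0"
    and gap: "\<And>x k. x \<in> R \<Longrightarrow> k \<noteq> 1 \<Longrightarrow> lin (\<beta> 1) x - lin (\<beta> k) x \<ge> g"
  shows "ennreal (g / 2) * emeasure D R * no_pref R t h \<le> round_regret \<beta> t h"
proof (cases "no_pref R t h = 0")
  case False
  have R': "R \<in> sets D" by (simp add: sets_D)
  have [measurable]: "(\<lambda>x. pmf (pol t h x) k) \<in> borel_measurable D" for k
    by (rule pmf_measurable_context[OF h])
  have "(\<integral>\<^sup>+ x. indicator R x * (if pmf (pol t h x) 0 < pmf (pol t h x) 1 then 1 else 0) \<partial>D) = 0"
    using False by (simp add: no_pref_def split: if_splits)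
  then have AE: "AE x in D. x \<in> R \<longrightarrow> pmf (pol t h x) 1 \<le> pmf (pol t h x) 0"
    by (subst (asm) nn_integral_0_iff_AE) (auto elim!: eventually_mono split: if_splits)
  have pw: "ennreal (g / 2) \<le> (\<Sum>k<K. ennreal (pmf (pol t h x) k) * ennreal (best_val K \<beta> x - lin (\<beta> k) x))"
    if x: "x \<in> R" and p: "pmf (pol t h x) 1 \<le> pmf (pol t h x) 0" for x
  proof -
    let ?p = "pmf (pol t h x)" and ?J = "{..<K} - {1}"
    have sp: "sum ?p ?J = 1 - ?p 1"
      using sum_pmf_eq_1[of t h x] K by (simp add: sum_diff1)
    have "?p 0 \<le> sum ?p ?J" using K by (intro member_le_sum) auto
    with p sp have half: "1 / 2 \<le> sum ?p ?J" by simp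
    have "{lin (\<beta> j) x |j. j < K} = (\<lambda>j. lin (\<beta> j) x) ` {..<K}" by auto
    then have best: "lin (\<beta> 1) x \<le> best_val K \<beta> x" unfolding best_val_def using K by (auto intro!: Max_ge)
    have "ennreal (g / 2) \<le> ennreal (sum ?p ?J * g)" using mult_right_mono[OF half g] by (intro ennreal_leI) simp
    also have "\<dots> = (\<Sum>k\<in>?J. ennreal (?p k) * ennreal g)"
      using g by (simp add: sum_distrib_right sum_ennreal flip: ennreal_mult)
    also have "\<dots> \<le> (\<Sum>k\<in>?J. ennreal (?p k) * ennreal (best_val K \<beta> x - lin (\<beta> k) x))"
      using gap[OF x] best by (intro sum_mono mult_left_mono ennreal_leI) (fastforce, simp)
    also have "\<dots> \<le> (\<Sum>k<K. ennreal (?p k) * ennreal (best_val K \<beta> x - lin (\<beta> k) x))"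
      by (intro sum_mono2) auto
    finally show ?thesis .
  qed
  have "ennreal (g / 2) * emeasure D R * no_pref R t h \<le> ennreal (g / 2) * emeasure D R * 1"
    by (intro mult_left_mono no_pref_le_1) simp
  also have "\<dots> = (\<integral>\<^sup>+ x. ennreal (g / 2) * indicator R x \<partial>D)"
    using R' by (simp add: nn_integral_cmult_indicator)
  also have "\<dots> \<le> round_regret \<beta> t h"
    unfolding round_regret_def using AE
    by (intro nn_integral_mono_AE) (auto elim!: eventually_mono intro: pw split: split_indicator)
  finally show ?thesis .
qed simp

end

text \<open>Here \<open>2 * (x \<bullet> dir) - 1\<close>, the lead of arm 1 over arm 0 under
  \<open>arms 0\<close>, lies between \<open>\<rho> / 2\<close> and \<open>\<rho>\<close>; raising
  arm 0 by \<open>\<rho>\<close> reverses the order.\<close>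

abbreviation region :: "nat \<Rightarrow> real \<Rightarrow> 'x::euclidean_space set" where
  "region K \<rho> \<equiv> slab K (1 / 2 + \<rho> / 4) (1 / 2 + \<rho> / 2)"

lemma region_bounds:
  assumes "x \<in> region K \<rho>"
  shows "1 / 2 + \<rho> / 4 < x \<bullet> dir" "x \<bullet> dir < 1 / 2 + \<rho> / 2"
  using assms by (auto simp: slab_def dest!: bspec[OF _ dir_Basis])

text \<open>Telescoping with \<open>ln (1 + 1 / n) \<le> 1 / n\<close>. This sum supplies the second
  logarithm of the bound.\<close>

lemma sum_inverse_ge_ln:
  assumes "1 \<le> m" "m \<le> n"
  shows "ln (real n) - ln (real m) \<le> (\<Sum>s\<in>{m..<n}. 1 / real s)"
  using assms(2)
proof (induction n rule: dec_induct)
  case (step n)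
  have "n > 0" using step assms(1) by simp
  then have "ln (real (Suc n)) - ln (real n) = ln (1 + 1 / real n)"
    by (subst ln_divide_pos[symmetric]) (simp_all add: field_simps)
  also have "\<dots> \<le> 1 / real n" by (rule ln_add_one_self_le_self) simp
  finally show ?case using step by simp
qed simp

text \<open>\<open>d\<close> is the allowed failure probability of fairness. The change of measure
  is used with Young parameter \<open>sqrt (real T)\<close>, which multiplies \<open>d\<close>;
  hence the last assumption.\<close>

locale fair_bandit =
  fixes K T :: nat and C d lam b pt :: real and pol :: "nat \<Rightarrow> 'x::euclidean_space hist \<Rightarrow> 'x \<Rightarrow> nat pmf"
  assumes K: "K \<ge> 2" and C: "C \<ge> 0"
    and inst: "\<And>\<rho>. 0 \<le> \<rho> \<Longrightarrow> \<rho> \<le> 1 / 4 \<Longrightarrow>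
      problem_instance K (real K) b 1 (1 / 8) pt lam 1 (ctx_dist K :: 'x measure) (arms \<rho>) std_normal"
    and fair: "pol \<in> fair_policies K (real K) b 1 (1 / 8) pt lam 1 T C d"
    and T: "T \<ge> 1" and d: "sqrt (real T) * d \<le> 1 / 4"
begin

sublocale bandit_process K "ctx_dist K :: 'x measure" std_normal pol
proof (rule bandit_process.intro)
  show "prob_space (ctx_dist K :: 'x measure)" "sets (ctx_dist K :: 'x measure) = sets borel"
    by (rule prob_space_ctx_dist[OF K], rule sets_ctx_dist)
  show "prob_space std_normal" by (rule prob_space_normal_density) simp
  show "admissible_policy K pol" using fair by (auto simp: fair_policies_def)
qed simp

abbreviation mean :: "(nat \<Rightarrow> 'x hist \<Rightarrow> 'x \<Rightarrow> nat \<Rightarrow> real) \<Rightarrow> real \<Rightarrow> nat \<Rightarrow> 'x hist \<Rightarrow> 'x \<Rightarrow> nat \<Rightarrow> real" where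
  "mean adv \<rho> \<equiv> \<lambda>t h x k. lin (arms \<rho> k) x + adv t h x k"

lemma mean_measurable:
  assumes "admissible_adversary T C adv"
  shows "measurable_mean (mean adv \<rho>)"
  unfolding measurable_mean_def
proof (intro allI)
  fix t k
  have [measurable]: "(\<lambda>p. adv t (fst p) (snd p) k) \<in> borel_measurable (hist_M t \<Otimes>\<^sub>M borel)"
    using assms by (simp add: admissible_adversary_def case_prod_beta')
  show "(\<lambda>(h, x). lin (arms \<rho> k) x + adv t h x k) \<in> borel_measurable (hist_M t \<Otimes>\<^sub>M borel)"
    unfolding case_prod_beta' by measurable
qed

lemma zero_adversary: "admissible_adversary T C (\<lambda>_ _ _ _. 0)"
  using C by (simp add: admissible_adversary_def)

lemma empty_hist_space: "empty_hist \<in> space (hist_M 0 :: 'x hist measure)"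
  by (simp add: empty_hist_def hist_M_def space_PiM)

lemma region_in_support:
  assumes "0 \<le> \<rho>" "\<rho> \<le> 1 / 4"
  shows "region K \<rho> \<subseteq> ctx_support (ctx_dist K :: 'x measure)"
proof -
  have "region K \<rho> \<subseteq> box (- real K *\<^sub>R One) (real K *\<^sub>R One :: 'x)"
    by (rule slab_subset_ctx_box[OF K]) (use assms K in auto)
  also note box_subset_ctx_support[OF K]
  finally show ?thesis .
qed

text \<open>Under uncorrupted \<open>arms \<rho>\<close> arm 0 is ahead on the region, so a fair
  round cannot prefer arm 1 there.\<close>

lemma expect_no_pref_alternative:
  assumes \<rho>: "0 \<le> \<rho>" "\<rho> \<le> 1 / 4" and s: "s < T"
  shows "ennreal (1 - d) \<le> expect_from s (mean (\<lambda>_ _ _ _. 0) \<rho>) (no_pref (region K \<rho>) s) 0 empty_hist"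
proof -
  have "ennreal (1 - d) \<le> fair_prob T K (arms \<rho>) (ctx_dist K :: 'x measure) std_normal (\<lambda>_ _ _ _. 0) pol"
    using fair inst[OF \<rho>] zero_adversary by (auto simp: fair_policies_def instances_def)
  also have "\<dots> \<le> expect_from s (mean (\<lambda>_ _ _ _. 0) \<rho>) (no_pref (region K \<rho>) s) 0 empty_hist"
    unfolding fair_prob_def
  proof (rule fair_prob_from_le_expect[OF _ s])
    fix h assume f: "fair_round K (arms \<rho>) (ctx_dist K :: 'x measure) pol (0 + s) h"
    show "1 \<le> no_pref (region K \<rho>) s h"
      by (rule no_pref_fair_round[OF region_in_support[OF \<rho>] _ _ f[simplified]])
        (use K in \<open>auto simp: lin_arms dest: region_bounds(2)\<close>)
  qed
  finally show ?thesis .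
qed

text \<open>The true instance is \<open>arms 0\<close> with \<open>adv\<close>, the alternative is
  \<open>arms \<rho>\<close> without corruption, and \<open>\<Delta>\<close> bounds the difference
  of their observed means before round \<open>s\<close>. With \<open>l = sqrt (real T)\<close> the
  change of measure gives at least \<open>1 - l * d - exp (s * \<Delta>\<^sup>2) / (4 * l)\<close>,
  where each subtracted term is at most \<open>1 / 4\<close>.\<close>

lemma expect_no_pref_ge_half:
  assumes adv: "admissible_adversary T C adv" and \<rho>: "0 \<le> \<rho>" "\<rho> \<le> 1 / 4" and s: "s < T"
    and \<Delta>: "\<And>t h x k. t < s \<Longrightarrow> \<bar>adv t h x k - (if k = 0 then \<rho> else 0)\<bar> \<le> \<Delta>"
    and small: "real s * \<Delta>\<^sup>2 \<le> ln (real T) / 2"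
  shows "ennreal (1 / 2) \<le> expect_from s (mean adv 0) (no_pref (region K \<rho>) s) 0 empty_hist"
proof -
  let ?F = "no_pref (region K \<rho>) s"
  let ?G = "expect_from s (mean adv 0) ?F 0 empty_hist" and ?l = "sqrt (real T)"
  have l: "?l > 0" using T by simp
  \<comment> \<open>Keeps \<open>1 - d\<close> nonnegative, so that \<open>ennreal (1 - d)\<close>
    is not truncated.\<close>
  have dT: "d \<le> 1"
  proof (cases "d \<le> 0")
    case False
    then have "1 * d \<le> ?l * d" using T by (intro mult_right_mono) auto
    then show ?thesis using d by simp
  qed simp
  have "exp (real s * \<Delta>\<^sup>2) \<le> exp (ln (real T) / 2)" using small by simp
  also have "\<dots> = ?l" using T by (simp add: ln_sqrt[symmetric])
  finally have e: "exp (real s * \<Delta>\<^sup>2) / (4 * ?l) \<le> 1 / 4" using l by (simp add: field_simps)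
  have "?G \<le> 1" by (intro expect_from_le_1 no_pref_le_1)
  then obtain g where g: "?G = ennreal g" "g \<ge> 0" by (cases ?G) (auto simp: top_unique)
  have "ennreal ?l * ennreal (1 - d) + 1 \<le> ennreal ?l * expect_from s (mean (\<lambda>_ _ _ _. 0) \<rho>) ?F 0 empty_hist + 1"
    by (intro add_right_mono mult_left_mono expect_no_pref_alternative \<rho> s) simp
  also have "\<dots> \<le> ?G + ennreal (?l + exp (real s * \<Delta>\<^sup>2) / (4 * ?l))"
  proof (rule expect_from_change_of_measure)
    show "\<bar>mean adv 0 t h x k - mean (\<lambda>_ _ _ _. 0) \<rho> t h x k\<bar> \<le> \<Delta>" if "t < 0 + s" for t h x k
      using \<Delta>[of t h x k] that by (auto simp: lin_arms abs_minus_commute)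
  qed (use mean_measurable[OF adv] mean_measurable[OF zero_adversary, of \<rho>] adv zero_adversary no_pref_measurable empty_hist_space l no_pref_le_1 in auto)
  also have "\<dots> \<le> ennreal g + ennreal (?l + 1 / 4)"
    unfolding g by (intro add_left_mono ennreal_leI add_left_mono e)
  also have "ennreal ?l * ennreal (1 - d) + 1 = ennreal (?l * (1 - d) + 1)"
    using dT l by (simp add: ennreal_mult ennreal_plus)
  also have "ennreal g + ennreal (?l + 1 / 4) = ennreal (g + (?l + 1 / 4))"
    using g l by (subst ennreal_plus[symmetric]) auto
  finally have "?l * (1 - d) + 1 \<le> g + (?l + 1 / 4)"
    using g l by (subst (asm) ennreal_le_iff) auto
  then have "g \<ge> 1 / 2" using d by (simp add: algebra_simps)
  then show ?thesis unfolding g by (rule ennreal_leI)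
qed

text \<open>The region has probability \<open>\<rho> / (8 * K)\<close>, and at least half of the gap
  \<open>\<rho> / 2\<close> is lost on it.\<close>

lemma round_regret_region:
  assumes \<rho>: "0 \<le> \<rho>" "\<rho> \<le> 1 / 4" and h: "h \<in> space (hist_M s)"
  shows "ennreal (\<rho>\<^sup>2 / (32 * real K)) * no_pref (region K \<rho>) s h \<le> round_regret (arms 0) s h"
proof -
  have "ennreal (\<rho> / 2 / 2) * emeasure (ctx_dist K :: 'x measure) (region K \<rho>) * no_pref (region K \<rho>) s h
      \<le> round_regret (arms 0) s h"
  proof (rule round_regret_ge_no_pref[OF _ h])
    fix x :: 'x and k :: nat assume x: "x \<in> region K \<rho>" and k: "k \<noteq> 1"
    show "lin (arms 0 1) x - lin (arms 0 k) x \<ge> \<rho> / 2"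
    proof (cases "k = 0")
      case True
      then show ?thesis using region_bounds(1)[OF x] by (simp add: lin_arms)
    next
      case False
      with k have k2: "real k \<ge> 2" by simp
      \<comment> \<open>On the region \<open>2 * (x \<bullet> dir) \<le> 5 / 4\<close>, so the arms
        beyond 1 are behind by at least 1.\<close>
      have "lin (arms 0 1) x - lin (arms 0 k) x = (real k - 1) * (real k + 1 - 2 * (x \<bullet> dir))"
        using False by (simp add: lin_arms power2_eq_square algebra_simps)
      also have "\<dots> \<ge> 1 * 1"
        using k2 region_bounds(2)[OF x] \<rho> by (intro mult_mono) auto
      finally show ?thesis using \<rho> by simp
    qed
  qed (use K \<rho> in auto)
  moreover have "emeasure (ctx_dist K :: 'x measure) (region K \<rho>) = ennreal (\<rho> / 4 / (2 * real K))"
    using K \<rho> by (subst emeasure_ctx_dist_slab[OF K]) auto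
  moreover have "ennreal (\<rho> / 2 / 2) * ennreal (\<rho> / 4 / (2 * real K)) = ennreal (\<rho>\<^sup>2 / (32 * real K))"
    using \<rho> by (subst ennreal_mult[symmetric]) (auto simp: power2_eq_square)
  ultimately show ?thesis by simp
qed

text \<open>The instance \<open>arms 0\<close> and the adversary stay fixed; only the alternative
  \<open>arms (\<rho> s)\<close> that bounds round \<open>s\<close> varies with \<open>s\<close>.
  The factor 64 is 32 times the 2 from the expectation bound \<open>1 / 2\<close>.\<close>

lemma regret_ge_sum:
  assumes adv: "admissible_adversary T C adv" and \<rho>: "\<And>s. 0 \<le> \<rho> s \<and> \<rho> s \<le> 1 / 4" and J: "J \<subseteq> {..<T}"
    and \<Delta>: "\<And>s t h x k. s \<in> J \<Longrightarrow> t < s \<Longrightarrow> \<bar>adv t h x k - (if k = 0 then \<rho> s else 0)\<bar> \<le> \<Delta> s"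
    and small: "\<And>s. s \<in> J \<Longrightarrow> real s * (\<Delta> s)\<^sup>2 \<le> ln (real T) / 2"
  shows "ennreal (\<Sum>s\<in>J. (\<rho> s)\<^sup>2 / (64 * real K)) \<le> regret T K (arms 0) (ctx_dist K :: 'x measure) std_normal adv pol"
proof -
  let ?w = "\<lambda>s. ennreal ((\<rho> s)\<^sup>2 / (32 * real K))"
  let ?E = "\<lambda>s. expect_from s (mean adv 0) (no_pref (region K (\<rho> s)) s) 0 empty_hist"
  have w: "?w s * ennreal (1 / 2) = ennreal ((\<rho> s)\<^sup>2 / (64 * real K))" for s
    by (subst ennreal_mult[symmetric]) auto
  have "ennreal (\<Sum>s\<in>J. (\<rho> s)\<^sup>2 / (64 * real K)) = (\<Sum>s\<in>J. ?w s * ennreal (1 / 2))"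
    unfolding w by (rule sum_ennreal[symmetric]) simp
  also have "\<dots> \<le> (\<Sum>s\<in>J. ?w s * ?E s)"
  proof (intro sum_mono mult_left_mono)
    fix s assume s: "s \<in> J"
    show "ennreal (1 / 2) \<le> ?E s"
      by (rule expect_no_pref_ge_half[OF adv _ _ _ \<Delta>[OF s] small[OF s]]) (use s J \<rho> in auto)
  qed simp
  also have "\<dots> \<le> (\<Sum>s<T. ?w s * ?E s)"
    using J by (intro sum_mono2) auto
  also have "\<dots> \<le> regret T K (arms 0) (ctx_dist K :: 'x measure) std_normal adv pol"
  proof -
    have "ennreal ((\<rho> s)\<^sup>2 / (32 * real K)) * no_pref (region K (\<rho> s)) s h \<le> round_regret (arms 0) s h"
      if "h \<in> space (hist_M s)" for s h
      by (rule round_regret_region[OF _ _ that]) (use \<rho>[of s] in blast)+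
    from regret_from_ge_sum[OF mean_measurable[OF adv] no_pref_measurable[OF slab_measurable] this empty_hist_space, of T]
    show ?thesis unfolding regret_def add_0 .
  qed
  finally show ?thesis .
qed

lemma regret_ge_ln_sq:
  assumes "ln (real T) \<ge> 1" "ln (real T) + 1 \<le> sqrt (real T)"
  shows "ennreal ((ln (real T))\<^sup>2 / (2048 * real K))
    \<le> regret T K (arms 0) (ctx_dist K :: 'x measure) std_normal (\<lambda>_ _ _ _. 0) pol"
proof -
  let ?L = "ln (real T)"
  define m where "m = nat \<lceil>?L\<rceil>"
  have m: "real m \<ge> ?L" "real m \<le> ?L + 1" "m \<ge> 1" using assms(1) unfolding m_def by linarith+
  have mT: "real m \<le> sqrt (real T)" using m assms by simp
  also have "sqrt (real T) \<le> real T"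
    using T self_le_power[of "real T" 2] by (intro real_le_lsqrt) auto
  finally have mT': "m \<le> T" by simp
  \<comment> \<open>From \<open>s \<ge> m \<ge> ?L\<close> on,
    \<open>s * (\<rho> s)\<^sup>2 = ?L / 16\<close> stays within the limit \<open>?L / 2\<close>,
    and \<open>\<rho> s \<le> 1 / 4\<close>. The sum starts at \<open>m\<close>; the value
    \<open>1 / 4\<close> below it keeps \<open>\<rho>\<close> in range.\<close>
  define \<rho> where "\<rho> s = (if s < m then 1 / 4 else sqrt (?L / (16 * real s)))" for s
  have \<rho>2: "(\<rho> s)\<^sup>2 = ?L / (16 * real s)" if "s \<ge> m" for s
    using that assms(1) by (simp add: \<rho>_def)
  have \<rho>: "0 \<le> \<rho> s \<and> \<rho> s \<le> 1 / 4" for s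
  proof (cases "s < m")
    case False
    then have "real m \<le> real s" by simp
    then have "?L / (16 * real s) \<le> (1 / 4)\<^sup>2" using m assms(1) by (simp add: field_simps power2_eq_square)
    then have "sqrt (?L / (16 * real s)) \<le> 1 / 4" by (intro real_le_lsqrt) auto
    then show ?thesis using False assms(1) by (simp add: \<rho>_def)
  qed (simp add: \<rho>_def)
  have "ennreal (\<Sum>s\<in>{m..<T}. (\<rho> s)\<^sup>2 / (64 * real K))
      \<le> regret T K (arms 0) (ctx_dist K :: 'x measure) std_normal (\<lambda>_ _ _ _. 0) pol"
  proof (rule regret_ge_sum[OF zero_adversary \<rho>])
    show "\<bar>0 - (if k = 0 then \<rho> s else 0)\<bar> \<le> \<rho> s" for s and k :: nat using \<rho>[of s] by auto
    show "real s * (\<rho> s)\<^sup>2 \<le> ?L / 2" if "s \<in> {m..<T}" for s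
      using that m assms(1) by (simp add: \<rho>2)
  qed auto
  moreover have "?L\<^sup>2 / (2048 * real K) \<le> (\<Sum>s\<in>{m..<T}. (\<rho> s)\<^sup>2 / (64 * real K))"
  proof -
    \<comment> \<open>As \<open>m \<le> sqrt (real T)\<close>, dropping the first \<open>m\<close>
      rounds costs at most half of the logarithm; the constant is 16 * 64 * 2 = 2048.\<close>
    have "ln (real m) \<le> ln (sqrt (real T))" using mT m T by (subst ln_le_cancel_iff) auto
    also have "\<dots> = ?L / 2" using T by (simp add: ln_sqrt)
    finally have "?L / 2 \<le> ?L - ln (real m)" by simp
    also have "\<dots> \<le> (\<Sum>s\<in>{m..<T}. 1 / real s)" by (rule sum_inverse_ge_ln[OF m(3) mT'])
    finally have "?L / (1024 * real K) * (?L / 2) \<le> ?L / (1024 * real K) * (\<Sum>s\<in>{m..<T}. 1 / real s)"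
      using assms(1) by (intro mult_left_mono) auto
    also have "\<dots> = (\<Sum>s\<in>{m..<T}. (\<rho> s)\<^sup>2 / (64 * real K))"
      unfolding sum_distrib_left by (intro sum.cong refl) (simp add: \<rho>2)
    finally show ?thesis by (simp add: power2_eq_square)
  qed
  ultimately show ?thesis by (rule order_trans[OF ennreal_leI, rotated])
qed

text \<open>Raising arm 0 by \<open>1 / 4\<close> in the first \<open>m\<close> rounds makes the
  observations there look like those of uncorrupted \<open>arms (1 / 4)\<close>. So
  \<open>\<Delta> = 0\<close>, and each of these rounds costs \<open>1 / (1024 * K)\<close>.\<close>

lemma regret_ge_budget:
  assumes "C \<ge> 1" "C \<le> real T"
  shows "\<exists>adv. admissible_adversary T C adv \<and>
    ennreal (C / (2048 * real K)) \<le> regret T K (arms 0) (ctx_dist K :: 'x measure) std_normal adv pol"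
proof -
  \<comment> \<open>As \<open>C \<ge> 1\<close>, rounding down loses at most a factor 2, which turns
    1024 into 2048.\<close>
  define m where "m = nat \<lfloor>C\<rfloor>"
  have "real m = real_of_int \<lfloor>C\<rfloor>" "1 \<le> \<lfloor>C\<rfloor>" using assms(1) by (simp_all add: m_def)
  then have m: "real m \<le> C" "C \<le> 2 * real m" by linarith+
  with assms(2) have mT: "m \<le> T" by simp
  define adv :: "nat \<Rightarrow> 'x hist \<Rightarrow> 'x \<Rightarrow> nat \<Rightarrow> real" where
    "adv = (\<lambda>t h x k. if t < m \<and> k = 0 then 1 / 4 else 0)"
  have "(\<Sum>t<T. \<bar>adv t (prefix_hist H t) (fst (H t)) (fst (snd (H t)))\<bar>) \<le> C" for H
  proof -
    have "(\<Sum>t<T. \<bar>adv t (prefix_hist H t) (fst (H t)) (fst (snd (H t)))\<bar>) \<le> (\<Sum>t<T. if t < m then 1 else 0)"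
      by (intro sum_mono) (auto simp: adv_def)
    also have "\<dots> = real (card ({..<T} \<inter> {..<m}))" by (simp add: sum.If_cases lessThan_def)
    also have "\<dots> = real m" using mT by (simp add: Int_absorb1)
    finally show ?thesis using m(1) by simp
  qed
  then have adm: "admissible_adversary T C adv"
    unfolding admissible_adversary_def by (simp add: adv_def)
  have "ennreal (\<Sum>s\<in>{..<m}. (1 / 4)\<^sup>2 / (64 * real K))
      \<le> regret T K (arms 0) (ctx_dist K :: 'x measure) std_normal adv pol"
    by (rule regret_ge_sum[OF adm, of "\<lambda>_. 1 / 4" _ "\<lambda>_. 0"]) (use mT T in \<open>auto simp: adv_def\<close>)
  moreover have "C / (2048 * real K) \<le> (\<Sum>s\<in>{..<m}. (1 / 4)\<^sup>2 / (64 * real K))"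
    using m(2) K by (simp add: field_simps power2_eq_square)
  ultimately have "ennreal (C / (2048 * real K)) \<le> regret T K (arms 0) (ctx_dist K :: 'x measure) std_normal adv pol"
    by (rule order_trans[OF ennreal_leI, rotated])
  with adm show ?thesis by blast
qed

end

text \<open>Mean rewards are bounded on the context support, so the regret is at most of order
  \<open>T\<close>; a bound linear in \<open>C\<close> is therefore stated for
  \<open>C \<le> real T\<close>.\<close>

theorem theorem10:
  fixes K :: nat and \<delta> :: "nat \<Rightarrow> real"
  assumes "K \<ge> 2"
    and "\<delta> \<in> \<Theta>(\<lambda>T. 1 / real T)"
  shows "\<exists>r b L hh pt lam \<sigma>. r \<ge> 1 \<and> b > 0 \<and> L > 0 \<and> hh > 0 \<and> pt > 0 \<and> lam > 0 \<and> \<sigma> > 0 \<and>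
    (\<exists>c>0. \<exists>T0. \<forall>T\<ge>T0. \<forall>C. 0 \<le> C \<and> C \<le> real T \<longrightarrow>
       (INF pol \<in> (fair_policies K r b L hh pt lam \<sigma> T C (\<delta> T) ::
                      (nat \<Rightarrow> 'x::euclidean_space hist \<Rightarrow> 'x \<Rightarrow> nat pmf) set).
          SUP (D, \<beta>, N, adv) \<in> instances K r b L hh pt lam \<sigma> T C.
            regret T K \<beta> D N adv pol)
       \<ge> ennreal (c * ((ln (real T))\<^sup>2 + C)))"
proof -
  define b pt where "b = (real K)\<^sup>2 + 2 * real K + 1" and "pt = (1 / (4 * real K)) ^ DIM('x)"
  obtain lam where lam: "lam > 0" and inst: "\<And>\<rho>. 0 \<le> \<rho> \<Longrightarrow> \<rho> \<le> 1 / 4 \<Longrightarrow>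
    problem_instance K (real K) b 1 (1 / 8) pt lam 1 (ctx_dist K :: 'x measure) (arms \<rho>) std_normal"
    using problem_instance_arms[OF assms(1), where 'x = 'x] unfolding b_def pt_def by blast
  from assms(2) obtain a where a: "a > 0" "\<forall>\<^sub>F T in at_top. norm (\<delta> T) \<le> a * norm (1 / real T)"
    by (auto simp: bigtheta_def elim!: landau_o.bigE)
  \<comment> \<open>From \<open>\<delta> T \<le> a / T\<close>, the product
    \<open>sqrt T * \<delta> T\<close> is at most \<open>a / sqrt T\<close>, which tends to
    0.\<close>
  have "\<forall>\<^sub>F T in at_top. a * sqrt (real T) / real T < 1 / 4"
    by (rule order_tendstoD(2)[of _ 0]) (real_asymp, simp)
  moreover have "\<forall>\<^sub>F T in at_top. ln (real T) + 1 \<le> sqrt (real T)" by real_asymp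
  moreover have "\<forall>\<^sub>F T in at_top. ln (real T) \<ge> 1" by real_asymp
  ultimately have "\<forall>\<^sub>F T in at_top. sqrt (real T) * \<delta> T \<le> 1 / 4 \<and> ln (real T) + 1 \<le> sqrt (real T) \<and>
      ln (real T) \<ge> 1 \<and> T \<ge> 1"
    using a(2) eventually_ge_at_top[of 1]
  proof eventually_elim
    case (elim T)
    have "sqrt (real T) * \<delta> T \<le> sqrt (real T) * (a * norm (1 / real T))"
      using elim by (intro mult_left_mono) auto
    also have "\<dots> = a * sqrt (real T) / real T" by simp
    finally show ?case using elim by (intro conjI) linarith+
  qed
  then obtain T0 where T0: "\<And>T. T \<ge> T0 \<Longrightarrow> sqrt (real T) * \<delta> T \<le> 1 / 4 \<and> ln (real T) + 1 \<le> sqrt (real T) \<and>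
      ln (real T) \<ge> 1 \<and> T \<ge> 1"
    by (auto simp: eventually_at_top_linorder)
  have "ennreal (1 / (4096 * real K) * ((ln (real T))\<^sup>2 + C))
      \<le> (INF pol \<in> (fair_policies K (real K) b 1 (1 / 8) pt lam 1 T C (\<delta> T) ::
                      (nat \<Rightarrow> 'x hist \<Rightarrow> 'x \<Rightarrow> nat pmf) set).
          SUP (D, \<beta>, N, adv) \<in> instances K (real K) b 1 (1 / 8) pt lam 1 T C. regret T K \<beta> D N adv pol)"
    if hT: "T \<ge> T0" and hC: "0 \<le> C" "C \<le> real T" for T C
  proof (rule INF_greatest)
    fix pol :: "nat \<Rightarrow> 'x hist \<Rightarrow> 'x \<Rightarrow> nat pmf"
    assume pol: "pol \<in> fair_policies K (real K) b 1 (1 / 8) pt lam 1 T C (\<delta> T)"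
    interpret fair_bandit K T C "\<delta> T" lam b pt pol
      by (rule fair_bandit.intro[OF assms(1) hC(1) inst pol]) (use T0[OF hT] in auto)
    let ?S = "SUP (D, \<beta>, N, adv) \<in> instances K (real K) b 1 (1 / 8) pt lam 1 T C. regret T K \<beta> D N adv pol"
    have S: "regret T K (arms 0) (ctx_dist K :: 'x measure) std_normal adv pol \<le> ?S"
      if "admissible_adversary T C adv" for adv
      by (rule SUP_upper2[of "(ctx_dist K, arms 0, std_normal, adv)"])
        (use that inst[of 0] in \<open>auto simp: instances_def\<close>)
    have ln: "ennreal ((ln (real T))\<^sup>2 / (2048 * real K)) \<le> ?S"
      by (rule order_trans[OF regret_ge_ln_sq S[OF zero_adversary]]) (use T0[OF hT] in blast)+
    have ln1: "(ln (real T))\<^sup>2 \<ge> 1" using T0[OF hT] by (simp add: one_le_power)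
    show "ennreal (1 / (4096 * real K) * ((ln (real T))\<^sup>2 + C)) \<le> ?S"
    \<comment> \<open>The larger of \<open>(ln (real T))\<^sup>2\<close> and \<open>C\<close> is at
      least half of their sum, which turns 2048 into 4096. If \<open>C\<close> is the larger one, it
      is at least 1, as the budget bound requires.\<close>
    proof (cases "C \<le> (ln (real T))\<^sup>2")
      case True
      then have "1 / (4096 * real K) * ((ln (real T))\<^sup>2 + C) \<le> (ln (real T))\<^sup>2 / (2048 * real K)"
        using assms(1) by (simp add: field_simps)
      then show ?thesis by (rule order_trans[OF ennreal_leI ln])
    next
      case False
      then have "C \<ge> 1" using ln1 by simp
      from regret_ge_budget[OF this hC(2)] obtain adv where adv: "admissible_adversary T C adv"
        "ennreal (C / (2048 * real K)) \<le> regret T K (arms 0) (ctx_dist K :: 'x measure) std_normal adv pol"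
        by blast
      have "ennreal (C / (2048 * real K)) \<le> ?S" by (rule order_trans[OF adv(2) S[OF adv(1)]])
      moreover have "1 / (4096 * real K) * ((ln (real T))\<^sup>2 + C) \<le> C / (2048 * real K)"
        using False assms(1) by (simp add: field_simps)
      ultimately show ?thesis by (rule order_trans[OF ennreal_leI, rotated])
    qed
  qed
  then have main: "\<exists>c>0. \<exists>T0. \<forall>T\<ge>T0. \<forall>C. 0 \<le> C \<and> C \<le> real T \<longrightarrow>
       (INF pol \<in> (fair_policies K (real K) b 1 (1 / 8) pt lam 1 T C (\<delta> T) ::
                      (nat \<Rightarrow> 'x::euclidean_space hist \<Rightarrow> 'x \<Rightarrow> nat pmf) set).
          SUP (D, \<beta>, N, adv) \<in> instances K (real K) b 1 (1 / 8) pt lam 1 T C.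
            regret T K \<beta> D N adv pol)
       \<ge> ennreal (c * ((ln (real T))\<^sup>2 + C))"
    using assms(1) by (intro exI[of _ "1 / (4096 * real K)"] conjI exI[of _ T0]) auto
  have "b > 0" "pt > 0" using assms(1) by (auto simp: b_def pt_def intro!: add_nonneg_pos)
  then show ?thesis
    by (rule_tac exI[of _ "real K"], rule_tac exI[of _ b], rule_tac exI[of _ 1], rule_tac exI[of _ "1 / 8"],
        rule_tac exI[of _ pt], rule_tac exI[of _ lam], rule_tac exI[of _ 1])
      (intro conjI main lam, use assms(1) in simp_all)
qed

end
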